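(* Let $\mathcal{M}$ be a rank $9$ Lawrence oriented matroid on $n$ elements with $\mathcal{M}\notin[C_9(n)]$. Then the following hold, where reorientation classes are counted among those of rank $9$ Lawrence oriented matroids on $\{1,\dots,n\}$ different from $[C_9(n)]$: (a) If $n=12$, then $f_{\mathcal{M}}(9,12,2)\le c_9(12,2)$, and there are exactly $511$ reorientation classes with $f_{\mathcal{M}}(9,12,2)=c_9(12,2)$. (b) If $n=12$, then $f_{\mathcal{M}}(9,12,3)\le c_9(12,3)$, and there are exactly $511$ reorientation classes with $f_{\mathcal{M}}(9,12,3)=c_9(12,3)$. (c) If $n=13$, then $f_{\mathcal{M}}(9,13,3)\le c_9(13,3)$, and there are exactly $1023$ reorientation classes with $f_{\mathcal{M}}(9,13,3)=c_9(13,3)$.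
   Context: An oriented matroid $\mathcal{M}=(E,\mathcal{C})$ is given by its finite ground set $E$ and its set $\mathcal{C}\subseteq\{+,-,0\}^E$ of signed circuits; for a sign vector $X$, $X^+$ and $X^-$ are the sets of positive and negative elements and $\underline{X}=X^+\cup X^-$ is the support. All oriented matroids are simple (all circuits have size at least $3$). For $R\subseteq E$, the reorientation ${}_{-R}\mathcal{M}$ is obtained from $\mathcal{M}$ by reversing the sign of $X_e$ for every $e\in R$ and every circuit $X$. The reorientation class $[\mathcal{M}]$ is the set of all ${}_{-R}\mathcal{M}$, $R\subseteq E$ (labelled ground set; no relabelling of elements is allowed). For an integer $k\ge 0$, $\mathcal{M}$ is $k$-neighborly if $|X^+|>k$ and $|X^-|>k$ for every circuit $X$. For an oriented matroid $\mathcal{M}$ of rank $r$ on $n$ elements, $f_{\mathcal{M}}(r,n,k)$ denotes the number of subsets $R\subseteq E$ such that ${}_{-R}\mathcal{M}$ is $k$-neighborly; it depends only on $[\mathcal{M}]$. The alternating oriented matroid $C_r(n)$ is the uniform oriented matroid of rank $r$ on $[n]=\{1,\dots,n\}$ in which every circuit $X$ with support $i_1<\dots<i_{r+1}$ satisfies $X_{i_j}=-X_{i_{j+1}}$ for $1\le j\le r$. Put $c_r(n,k)=f_{C_r(n)}(r,n,k)$. Lawrence oriented matroid (LOM): for an $r\times n$ matrix $A=(a_{i,j})$ with entries in $\{+1,-1\}$, $r\le n$, $\mathcal{M}_A$ is the uniform oriented matroid of rank $r$ on $[n]$ with chirotope $\chi(j_1,\dots,j_r)=\prod_{i=1}^r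 a_{i,j_i}$ for $j_1<\dots<j_r$. Equivalently, its circuits are the sign vectors $X$ with support $j_1<\dots<j_{r+1}$ such that $X_{j_{i+1}}=-X_{j_i}a_{i,j_i}a_{i,j_{i+1}}$ for $1\le i\le r$. A rank $r$ LOM on $n$ elements is an oriented matroid of the form $\mathcal{M}_A$ for such a matrix $A$. *)

theory Defs
  imports Main
begin

text \<open>A sign vector is an integer-valued function with values in \<open>{-1, 0, 1}\<close>. An oriented matroid is
  presented as the pair of its ground set and its set of signed circuits; its circuits are extended
  by \<open>0\<close> outside the ground set, so that equality of pairs is equality of labelled oriented
  matroids. The circuit axioms are not part of the type: only Lawrence oriented matroids, which are
  given explicitly and satisfy them, and their reorientations are considered below.\<close>

type_synonym 'a sign_vector = "'a \<Rightarrow> int"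

type_synonym 'a oriented_matroid = "'a set \<times> 'a sign_vector set"

definition sign_vectors :: "'a set \<Rightarrow> 'a sign_vector set" where
  "sign_vectors E = {X. (\<forall>e\<in>E. X e \<in> {-1, 0, 1}) \<and> (\<forall>e. e \<notin> E \<longrightarrow> X e = 0)}"

definition pos :: "'a sign_vector \<Rightarrow> 'a set" where
  "pos X = {e. X e = 1}"

definition neg :: "'a sign_vector \<Rightarrow> 'a set" where
  "neg X = {e. X e = -1}"

definition supp :: "'a sign_vector \<Rightarrow> 'a set" where
  "supp X = pos X \<union> neg X"

abbreviation ground :: "'a oriented_matroid \<Rightarrow> 'a set" where
  "ground M \<equiv> fst M"

abbreviation circuits :: "'a oriented_matroid \<Rightarrow> 'a sign_vector set" where
  "circuits M \<equiv> snd M"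

definition reorient_vector :: "'a set \<Rightarrow> 'a sign_vector \<Rightarrow> 'a sign_vector" where
  "reorient_vector R X = (\<lambda>e. if e \<in> R then - X e else X e)"

definition reorient :: "'a set \<Rightarrow> 'a oriented_matroid \<Rightarrow> 'a oriented_matroid" where
  "reorient R M = (ground M, reorient_vector R ` circuits M)"

definition reorientation_class :: "'a oriented_matroid \<Rightarrow> 'a oriented_matroid set" where
  "reorientation_class M = {reorient R M | R. R \<subseteq> ground M}"

definition neighborly :: "nat \<Rightarrow> 'a oriented_matroid \<Rightarrow> bool" where
  "neighborly k M \<longleftrightarrow> (\<forall>X\<in>circuits M. card (pos X) > k \<and> card (neg X) > k)"

text \<open>The number \<open>f\<^sub>M(r, n, k)\<close>; the rank \<open>r\<close> and the size \<open>n\<close> are determined by \<open>M\<close>.\<close>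

definition num_neighborly :: "'a oriented_matroid \<Rightarrow> nat \<Rightarrow> nat" where
  "num_neighborly M k = card {R. R \<subseteq> ground M \<and> neighborly k (reorient R M)}"

text \<open>In lists \<open>sorted_list_of_set S\<close> the paper's \<open>j\<^sub>i\<close> is the entry with index \<open>i - 1\<close>.\<close>

definition alternating_om :: "nat \<Rightarrow> nat \<Rightarrow> nat oriented_matroid" where
  "alternating_om r n =
     ({1..n}, {X \<in> sign_vectors {1..n}. card (supp X) = r + 1 \<and>
        (let js = sorted_list_of_set (supp X) in
          \<forall>i<r. X (js ! i) = - X (js ! Suc i))})"

text \<open>The uniform oriented matroid of rank \<open>r\<close> on \<open>{1..n}\<close> with chirotope \<open>\<chi>\<close>, where \<open>\<chi>\<close> is given by
  its values \<open>\<plusminus>1\<close> on increasing \<open>r\<close>-tuples. By the usual correspondence between chirotopes and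
  signed circuits, the two circuits with support \<open>j\<^sub>0 < \<dots> < j\<^sub>r\<close> are
  \<open>X (j\<^sub>i) = \<epsilon> (-1)\<^sup>i \<chi>(j\<^sub>0, \<dots>, j\<^sub>i\<^sub>-\<^sub>1, j\<^sub>i\<^sub>+\<^sub>1, \<dots>, j\<^sub>r)\<close> with \<open>\<epsilon> = \<plusminus>1\<close>.\<close>

definition uniform_om :: "nat \<Rightarrow> nat \<Rightarrow> (nat list \<Rightarrow> int) \<Rightarrow> nat oriented_matroid" where
  "uniform_om r n \<chi> =
     ({1..n}, {X \<in> sign_vectors {1..n}. card (supp X) = r + 1 \<and>
        (let js = sorted_list_of_set (supp X) in
          \<exists>\<epsilon>\<in>{-1, 1}. \<forall>i\<le>r. X (js ! i) = \<epsilon> * (-1) ^ i * \<chi> (take i js @ drop (Suc i) js))})"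

text \<open>An \<open>r \<times> n\<close> matrix is a function whose values at \<open>(i, j)\<close>, \<open>1 \<le> i \<le> r\<close>, \<open>1 \<le> j \<le> n\<close>, matter.\<close>

definition sign_matrix :: "nat \<Rightarrow> nat \<Rightarrow> (nat \<Rightarrow> nat \<Rightarrow> int) \<Rightarrow> bool" where
  "sign_matrix r n A \<longleftrightarrow> (\<forall>i\<in>{1..r}. \<forall>j\<in>{1..n}. A i j \<in> {-1, 1})"

definition lawrence_chirotope :: "nat \<Rightarrow> (nat \<Rightarrow> nat \<Rightarrow> int) \<Rightarrow> nat list \<Rightarrow> int" where
  "lawrence_chirotope r A js = (\<Prod>i = 1..r. A i (js ! (i - 1)))"

definition lawrence_om :: "nat \<Rightarrow> nat \<Rightarrow> (nat \<Rightarrow> nat \<Rightarrow> int) \<Rightarrow> nat oriented_matroid" where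
  "lawrence_om r n A = uniform_om r n (lawrence_chirotope r A)"

definition loms :: "nat \<Rightarrow> nat \<Rightarrow> nat oriented_matroid set" where
  "loms r n = {lawrence_om r n A | A. r \<le> n \<and> sign_matrix r n A}"

text \<open>The usual description of the circuits of a LOM by its matrix.\<close>

lemma circuits_lawrence_om:
  assumes A: "sign_matrix r n A"
  shows "circuits (lawrence_om r n A) =
     {X \<in> sign_vectors {1..n}. card (supp X) = r + 1 \<and>
        (let js = sorted_list_of_set (supp X) in
          \<forall>i<r. X (js ! Suc i) = - X (js ! i) * A (Suc i) (js ! i) * A (Suc i) (js ! Suc i))}"
proof -
  have main: "(\<exists>\<epsilon>\<in>{-1, 1}. \<forall>i\<le>r. X (js ! i) =
          \<epsilon> * (-1) ^ i * lawrence_chirotope r A (take i js @ drop (Suc i) js)) \<longleftrightarrow>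
        (\<forall>i<r. X (js ! Suc i) = - X (js ! i) * A (Suc i) (js ! i) * A (Suc i) (js ! Suc i))"
    if X: "X \<in> sign_vectors {1..n}" "card (supp X) = r + 1"
      and js: "js = sorted_list_of_set (supp X)" for X js
  proof -
    define P where "P i = lawrence_chirotope r A (take i js @ drop (Suc i) js)" for i
    have fin: "finite (supp X)" using X(2) card.infinite by fastforce
    have len: "length js = r + 1" using js X(2) by simp
    have set_js: "set js = supp X" using js fin by simp
    have "supp X \<subseteq> {1..n}"
      using X(1) by (auto simp: supp_def pos_def neg_def sign_vectors_def)
    then have js_in: "js ! i \<in> {1..n}" if "i \<le> r" for i
      using that len set_js by (metis Suc_eq_plus1 less_Suc_eq_le nth_mem subsetD)
    have A1: "A k (js ! i) \<in> {-1, 1}" if "k \<in> {1..r}" "i \<le> r" for k i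
      using A js_in[OF that(2)] that(1) by (auto simp: sign_matrix_def)
    define g where "g i k = A k (js ! (if k \<le> i then k - 1 else k))" for i k
    have P_eq: "P i = (\<Prod>k = 1..r. g i k)" if "i \<le> r" for i
      unfolding P_def lawrence_chirotope_def
    proof (rule prod.cong)
      fix k assume k: "k \<in> {1..r}"
      show "A k ((take i js @ drop (Suc i) js) ! (k - 1)) = g i k"
        using k that len by (auto simp: g_def nth_append min_def)
    qed simp
    have g1: "g i k \<in> {-1, 1}" if "k \<in> {1..r}" for i k
      unfolding g_def by (rule A1) (use that in auto)
    have prod1: "prod (g i) K \<in> {-1, 1}" if "K \<subseteq> {1..r}" for i K
    proof -
      have "finite K" using that finite_subset by blast
      then show ?thesis using that
      proof (induction K)
        case (insert k K)
        then show ?case using g1[of k i] by auto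
      qed simp
    qed
    have P1: "P i \<in> {-1, 1}" if "i \<le> r" for i
      using prod1[of "{1..r}" i] P_eq[OF that] by simp
    have PP: "P i * P (Suc i) = A (Suc i) (js ! i) * A (Suc i) (js ! Suc i)" if "i < r" for i
    proof -
      have *: "P m = g m (Suc i) * prod (g m) ({1..r} - {Suc i})" if "m \<le> r" for m
        using P_eq[OF that] \<open>i < r\<close> by (simp add: prod.remove)
      have "prod (g i) ({1..r} - {Suc i}) = prod (g (Suc i)) ({1..r} - {Suc i})"
        by (rule prod.cong) (auto simp: g_def le_Suc_eq)
      then have "P i * P (Suc i) = g i (Suc i) * g (Suc i) (Suc i) *
          (prod (g i) ({1..r} - {Suc i}) * prod (g i) ({1..r} - {Suc i}))"
        using *[of i] *[of "Suc i"] that by (simp add: ac_simps)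
      moreover have "prod (g i) ({1..r} - {Suc i}) * prod (g i) ({1..r} - {Suc i}) = 1"
        using prod1[of "{1..r} - {Suc i}" i] by auto
      ultimately show ?thesis by (simp add: g_def)
    qed
    have P_Suc: "P (Suc i) = P i * A (Suc i) (js ! i) * A (Suc i) (js ! Suc i)" if "i < r" for i
    proof -
      have "P i * P i = 1" using P1[of i] that by auto
      then have "P (Suc i) = P i * (P i * P (Suc i))" by (metis mult.assoc mult_1)
      then show ?thesis using PP[OF that] by (simp add: ac_simps)
    qed
    have "js ! 0 \<in> supp X" using len set_js by (metis Suc_eq_plus1 nth_mem zero_less_Suc)
    then have X0: "X (js ! 0) \<in> {-1, 1}" by (auto simp: supp_def pos_def neg_def)
    show ?thesis unfolding P_def[symmetric]
    proof
      assume "\<exists>\<epsilon>\<in>{-1, 1}. \<forall>i\<le>r. X (js ! i) = \<epsilon> * (-1) ^ i * P i"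
      then obtain \<epsilon> where "\<And>i. i \<le> r \<Longrightarrow> X (js ! i) = \<epsilon> * (-1) ^ i * P i" by blast
      then show "\<forall>i<r. X (js ! Suc i) =
          - X (js ! i) * A (Suc i) (js ! i) * A (Suc i) (js ! Suc i)"
        using P_Suc by (simp add: ac_simps)
    next
      assume step: "\<forall>i<r. X (js ! Suc i) =
          - X (js ! i) * A (Suc i) (js ! i) * A (Suc i) (js ! Suc i)"
      define \<epsilon> where "\<epsilon> = X (js ! 0) * P 0"
      have "\<epsilon> \<in> {-1, 1}" using X0 P1[of 0] by (auto simp: \<epsilon>_def)
      moreover have "i \<le> r \<Longrightarrow> X (js ! i) = \<epsilon> * (-1) ^ i * P i" for i
      proof (induction i)
        case 0
        show ?case using P1[of 0] by (auto simp: \<epsilon>_def)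
      next
        case (Suc i)
        then show ?case using step P_Suc[of i] by (simp add: ac_simps)
      qed
      ultimately show "\<exists>\<epsilon>\<in>{-1, 1}. \<forall>i\<le>r. X (js ! i) = \<epsilon> * (-1) ^ i * P i" by blast
    qed
  qed
  show ?thesis
    unfolding lawrence_om_def uniform_om_def Let_def snd_conv
    by (rule Collect_cong) (use main in blast)
qed

lemma lawrence_om_const_1: "lawrence_om r n (\<lambda>i j. 1) = alternating_om r n"
proof -
  have "circuits (lawrence_om r n (\<lambda>i j. 1)) = circuits (alternating_om r n)"
    by (subst circuits_lawrence_om)
      (auto simp: sign_matrix_def alternating_om_def Let_def minus_equation_iff)
  then show ?thesis
    by (simp add: lawrence_om_def uniform_om_def alternating_om_def)
qed

text \<open>The number \<open>c\<^sub>r(n, k)\<close>.\<close>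

definition alternating_num :: "nat \<Rightarrow> nat \<Rightarrow> nat \<Rightarrow> nat" where
  "alternating_num r n k = num_neighborly (alternating_om r n) k"

text \<open>The reorientation classes of rank \<open>r\<close> LOMs on \<open>{1..n}\<close> other than that of \<open>C\<^sub>r(n)\<close> for which the
  number of \<open>k\<close>-neighborly reorientations is \<open>c\<^sub>r(n, k)\<close>.\<close>

definition extremal_lom_classes :: "nat \<Rightarrow> nat \<Rightarrow> nat \<Rightarrow> nat oriented_matroid set set" where
  "extremal_lom_classes r n k =
     {reorientation_class M | M. M \<in> loms r n \<and> M \<notin> reorientation_class (alternating_om r n) \<and>
        num_neighborly M k = alternating_num r n k}"

end

theory Submission
  imports Defs
begin

text \<open>
  Write \<open>r\<close> for the rank and \<open>n = r + l + 1\<close> for the number of elements. A circuit of the Lawrence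
  oriented matroid of \<open>A\<close> is read off a staircase path through \<open>A\<close>: the path enters row \<open>i\<close> in
  column \<open>j\<^sub>i\<close>, moves right to column \<open>j\<^sub>i\<^sub>+\<^sub>1\<close> and steps down, and the sign changes exactly if the two
  entries of row \<open>i\<close> are equal. Reorienting amounts to changing the signs of columns of \<open>A\<close>
  (\<open>reorient_lawrence_om\<close>), so the number of \<open>k\<close>-neighborly reorientations is the number of column
  sign changes after which every path has more than \<open>k\<close> positive elements.

  Three ideas make this number accessible.

  First, the paths can be followed row by row. Up to complementation, a column sign change is a bit
  for each pair of consecutive columns, and all that matters about the rows already read is, for each
  column offset and each current sign, how many positive elements a path still needs. This is a
  tropical recursion on very few states (\<open>step\<close>, \<open>neighborly_iff_survives\<close>), and a state can be
  discarded as soon as its two needs at one offset add up to more than the number of remaining rows.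

  Second, the reorientation class is the chessboard of \<open>A\<close>: for consecutive rows and
  consecutive columns, whether the product of the four entries is negative. Only the squares that
  some path can see count, there are \<open>l\<close> of them for each pair of consecutive rows, and so the
  classes correspond to the words of length \<open>r - 1\<close> over an alphabet of \<open>2 ^ l\<close> letters
  (\<open>reorientation_class_eq_iff\<close>, \<open>chessboard_word_matrix\<close>). The class of the alternating oriented
  matroid is the all-white word. The states of the first part form an automaton that reads this word,
  and the number of neighborly reorientations is twice the number of its accepting runs
  (\<open>count\<close>, \<open>num_neighborly_eq\<close>).

  Third, this number is maximal exactly for the regular words, those whose chessboards have constant
  columns. There are \<open>2 ^ (n - 3)\<close> of them (\<open>card_regular_words\<close>), which gives \<open>511\<close> and \<open>1023\<close> after
  removing the all-white word. That all regular words have the same number of runs and all others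
  have fewer is a finite computation: words are extended to the left, the function that counts the
  accepting runs from each state is kept in a trie, regular words with the same first letter share
  their function, and the functions of irregular words are merged by taking pointwise maxima. At
  most a few dozen merged functions per row suffice to stay below the value of the alternating
  oriented matroid. \<open>verified_count\<close> is the soundness of this computation, and \<open>lom_extremality\<close>
  draws the conclusion for oriented matroids.
\<close>

section \<open>Positive elements still needed by paths\<close>

text \<open>A list of needs describes all paths that have reached a given row: its entry at \<open>e\<close>
  says how many further positive elements are required by the paths that stand at offset \<open>e\<close> from the
  diagonal, separately for a negative and for a positive current element.\<close>
datatype need = Need (after_minus: nat) (after_plus: nat)

definition need_of :: "need list \<Rightarrow> nat \<Rightarrow> bool \<Rightarrow> nat" where
  "need_of g e Y = (if Y then after_plus (g ! e) else after_minus (g ! e))"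

text \<open>One row acts on the needs. The bit \<open>d\<close> says whether two neighbouring entries of the row
  differ. From left to right, \<open>a\<close> and \<open>b\<close> collect the largest needs of the paths that
  move to the right, sorted by the sign that the path would have if it had started in the current column: passing
  a column change swaps the two. Since the sign flips between equal entries, a path with virtual sign
  \<open>-\<close> goes down with sign \<open>+\<close>, and its need decreases by one.\<close>
fun scan :: "nat \<Rightarrow> nat \<Rightarrow> bool list \<Rightarrow> need list \<Rightarrow> need list"
  and turn :: "nat \<Rightarrow> nat \<Rightarrow> bool \<Rightarrow> bool list \<Rightarrow> need list \<Rightarrow> need list" where
  "scan a b (d # ds) (Need p q # g) = turn (max a p) (max b q) d ds g"
| "scan a b _ _ = []"
| "turn a b True ds g = Need a (b - 1) # scan b a ds g"
| "turn a b False ds g = Need b (a - 1) # scan a b ds g"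

definition step :: "bool list \<Rightarrow> need list \<Rightarrow> need list" where
  "step d g = scan 0 0 d g"

text
  \<open>The conditional instead of a conjunction makes evaluation by rewriting stop at the first failure; the same device is used in other tests below.\<close>
fun alive :: "nat \<Rightarrow> need list \<Rightarrow> bool" where
  "alive n [] = True"
| "alive n (Need p q # g) = (if p + q \<le> n then alive n g else False)"

definition changes :: "nat \<Rightarrow> (nat \<Rightarrow> bool) \<Rightarrow> bool list" where
  "changes m \<beta> = map (\<lambda>j. \<beta> j \<noteq> \<beta> (Suc j)) [0..<m]"

lemma length_changes [simp]: "length (changes m \<beta>) = m"
  by (simp add: changes_def)

lemma changes_Suc: "changes (Suc m) \<beta> = (\<beta> 0 \<noteq> \<beta> (Suc 0)) # changes m (\<beta> \<circ> Suc)"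
  by (simp add: changes_def upt_conv_Cons map_Suc_upt [symmetric] o_def del: upt_Suc)

lemma length_scan: "length (scan a b d g) = min (length d) (length g)"
proof (induction g arbitrary: a b d)
  case (Cons x g)
  then show ?case
    by (cases x; cases d; cases "hd d") auto
qed simp

lemma length_step: "length d = length g \<Longrightarrow> length (step d g) = length g"
  by (simp add: step_def length_scan)

text \<open>The row as a function \<open>\<beta>\<close> of the column: a path from offset \<open>e\<close> that
  goes down at offset \<open>f\<close> with sign \<open>Z\<close> had sign \<open>Z\<close> before exactly if
  \<open>\<beta> e\<close> and \<open>\<beta> (f + 1)\<close> differ. The initial values \<open>a\<close> and
  \<open>b\<close> behave like needs at offset \<open>0\<close>.\<close>
lemma need_of_scan_le:
  assumes "f < length g"
  shows "need_of (scan a b (changes (length g) \<beta>) g) f Z \<le> c \<longleftrightarrow>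
     (if Z \<noteq> (\<beta> 0 = \<beta> (Suc f)) then b else a) - of_bool Z \<le> c \<and>
     (\<forall>e\<le>f. need_of g e (Z \<noteq> (\<beta> e = \<beta> (Suc f))) - of_bool Z \<le> c)"
  using assms
proof (induction g arbitrary: a b \<beta> f)
  case (Cons x g)
  obtain p q where x: "x = Need p q" by (cases x)
  show ?case
  proof (cases f)
    case 0
    show ?thesis
      by (cases "\<beta> 0 = \<beta> (Suc 0)"; cases Z) (auto simp: x 0 changes_Suc need_of_def)
  next
    case (Suc f')
    with Cons.prems have f': "f' < length g" by simp
    define a1 b1 a2 b2 where "a1 = max a p" and "b1 = max b q"
      and "a2 = (if \<beta> 0 = \<beta> (Suc 0) then a1 else b1)" and "b2 = (if \<beta> 0 = \<beta> (Suc 0) then b1 else a1)"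
    have scan: "need_of (scan a b (changes (length (x # g)) \<beta>) (x # g)) f Z =
        need_of (scan a2 b2 (changes (length g) (\<beta> \<circ> Suc)) g) f' Z"
      by (cases "\<beta> 0 = \<beta> (Suc 0)") (simp_all add: x Suc changes_Suc need_of_def a1_def b1_def a2_def b2_def)
    have carry: "(if Z \<noteq> (\<beta> (Suc 0) = \<beta> (Suc f)) then b2 else a2) =
        (if Z \<noteq> (\<beta> 0 = \<beta> (Suc f)) then b1 else a1)"
      by (auto simp: a2_def b2_def)
    have head: "(if Z \<noteq> (\<beta> 0 = \<beta> (Suc f)) then b1 else a1) - of_bool Z \<le> c \<longleftrightarrow>
        (if Z \<noteq> (\<beta> 0 = \<beta> (Suc f)) then b else a) - of_bool Z \<le> c \<and>
        need_of (x # g) 0 (Z \<noteq> (\<beta> 0 = \<beta> (Suc f))) - of_bool Z \<le> c"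
      by (cases "Z \<noteq> (\<beta> 0 = \<beta> (Suc f))") (auto simp: a1_def b1_def x need_of_def)
    have all: "(\<forall>e\<le>f. P e) \<longleftrightarrow> P 0 \<and> (\<forall>e\<le>f'. P (Suc e))" for P
      unfolding Suc by (metis Suc_le_mono le0 not0_implies_Suc)
    have IH: "need_of (scan a2 b2 (changes (length g) (\<beta> \<circ> Suc)) g) f' Z \<le> c \<longleftrightarrow>
        (if Z \<noteq> (\<beta> (Suc 0) = \<beta> (Suc f)) then b2 else a2) - of_bool Z \<le> c \<and>
        (\<forall>e\<le>f'. need_of (x # g) (Suc e) (Z \<noteq> (\<beta> (Suc e) = \<beta> (Suc f))) - of_bool Z \<le> c)"
      unfolding Cons.IH [OF f'] Suc by (simp only: o_apply need_of_def nth_Cons_Suc)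
    show ?thesis
      unfolding scan IH carry head all by (rule conj_assoc)
  qed
qed simp

text \<open>The meaning of needs: all paths through the rows \<open>\<beta>s\<close> that start at offset
  \<open>e\<close> with sign \<open>Y\<close> meet at least \<open>h\<close> positive elements after the current
  one.\<close>
fun yields :: "nat \<Rightarrow> (nat \<Rightarrow> bool) list \<Rightarrow> nat \<Rightarrow> bool \<Rightarrow> nat \<Rightarrow> bool" where
  "yields m [] e Y h \<longleftrightarrow> h = 0"
| "yields m (\<beta> # \<beta>s) e Y h \<longleftrightarrow> (\<forall>f\<in>{e..<m}.
     yields m \<beta>s f (Y \<noteq> (\<beta> e = \<beta> (Suc f))) (h - of_bool (Y \<noteq> (\<beta> e = \<beta> (Suc f)))))"

text \<open>Hence a maximum of needs is met if and only if each of them is met, which is why \<open>scan\<close>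
  may forget all but the largest need.\<close>
lemma yields_threshold: "e < m \<Longrightarrow> \<exists>c. \<forall>h. yields m \<beta>s e Y h \<longleftrightarrow> h \<le> c"
proof (induction \<beta>s arbitrary: e Y)
  case (Cons \<beta> \<beta>s)
  define Z where "Z f = (Y \<noteq> (\<beta> e = \<beta> (Suc f)))" for f
  have "\<forall>f. \<exists>c. f < m \<longrightarrow> (\<forall>h. yields m \<beta>s f (Z f) h \<longleftrightarrow> h \<le> c)"
    using Cons.IH by blast
  from choice [OF this] obtain c where c: "\<And>f h. f < m \<Longrightarrow> yields m \<beta>s f (Z f) h \<longleftrightarrow> h \<le> c f"
    by blast
  \<comment> \<open>The threshold is the least number of positive elements over all paths.\<close>
  define C where "C = (\<lambda>f. c f + of_bool (Z f)) ` {e..<m}"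
  have C: "finite C" "C \<noteq> {}" using Cons.prems by (auto simp: C_def)
  have "yields m (\<beta> # \<beta>s) e Y h \<longleftrightarrow> h \<le> Min C" for h
  proof -
    have "yields m (\<beta> # \<beta>s) e Y h \<longleftrightarrow> (\<forall>f\<in>{e..<m}. h - of_bool (Z f) \<le> c f)"
      using c by (simp add: Z_def)
    also have "\<dots> \<longleftrightarrow> (\<forall>y\<in>C. h \<le> y)" by (auto simp: C_def le_diff_conv)
    finally show ?thesis using C by simp
  qed
  then show ?case by blast
qed auto

lemma yields_step:
  assumes "length g = m"
  shows "(\<forall>e<m. \<forall>Y. yields m (\<beta> # \<beta>s) e Y (need_of g e Y)) \<longleftrightarrow>
         (\<forall>f<m. \<forall>Z. yields m \<beta>s f Z (need_of (step (changes m \<beta>) g) f Z))"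
proof -
  have "yields m \<beta>s f Z (need_of (step (changes m \<beta>) g) f Z) \<longleftrightarrow>
      (\<forall>e\<le>f. yields m \<beta>s f Z (need_of g e (Z \<noteq> (\<beta> e = \<beta> (Suc f))) - of_bool Z))" if f: "f < m" for f Z
  proof -
    obtain c where c: "\<And>h. yields m \<beta>s f Z h \<longleftrightarrow> h \<le> c" using yields_threshold [OF f] by blast
    show ?thesis
      using need_of_scan_le [of f g 0 0 \<beta> Z c] f assms by (simp add: c step_def)
  qed
  moreover have "(\<forall>e<m. \<forall>Y. yields m (\<beta> # \<beta>s) e Y (need_of g e Y)) \<longleftrightarrow>
      (\<forall>f<m. \<forall>Z. \<forall>e\<le>f. yields m \<beta>s f Z (need_of g e (Z \<noteq> (\<beta> e = \<beta> (Suc f))) - of_bool Z))"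
    (is "?l \<longleftrightarrow> ?r")
  proof
    assume l: ?l
    show ?r
    proof (intro allI impI)
      fix f Z e assume "f < m" "e \<le> f"
      then have "yields m (\<beta> # \<beta>s) e (Z \<noteq> (\<beta> e = \<beta> (Suc f))) (need_of g e (Z \<noteq> (\<beta> e = \<beta> (Suc f))))"
        using l by (meson le_less_trans)
      then show "yields m \<beta>s f Z (need_of g e (Z \<noteq> (\<beta> e = \<beta> (Suc f))) - of_bool Z)"
        using \<open>f < m\<close> \<open>e \<le> f\<close>
        by (cases "\<beta> e = \<beta> (Suc f)") (auto dest!: bspec [where x = f])
    qed
  next
    assume r: ?r
    show ?l
    proof (intro allI impI)
      fix e Y assume "e < m"
      have "yields m \<beta>s f (Y \<noteq> (\<beta> e = \<beta> (Suc f)))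
          (need_of g e Y - of_bool (Y \<noteq> (\<beta> e = \<beta> (Suc f))))" if "f \<in> {e..<m}" for f
        using r [rule_format, of f e "Y \<noteq> (\<beta> e = \<beta> (Suc f))"] that
        by (cases "\<beta> e = \<beta> (Suc f)") auto
      then show "yields m (\<beta> # \<beta>s) e Y (need_of g e Y)" by simp
    qed
  qed
  ultimately show ?thesis by auto
qed

fun survives :: "bool list list \<Rightarrow> need list \<Rightarrow> bool" where
  "survives [] g \<longleftrightarrow> alive 0 g"
| "survives (d # ds) g \<longleftrightarrow> survives ds (step d g)"

lemma alive_0_iff: "alive 0 g \<longleftrightarrow> (\<forall>e<length g. \<forall>Y. need_of g e Y = 0)"
proof (induction g)
  case (Cons x g)
  then show ?case by (cases x) (auto simp: need_of_def nth_Cons split: nat.splits if_splits)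
qed simp

lemma survives_iff_yields:
  "length g = m \<Longrightarrow> survives (map (changes m) \<beta>s) g \<longleftrightarrow> (\<forall>e<m. \<forall>Y. yields m \<beta>s e Y (need_of g e Y))"
proof (induction \<beta>s arbitrary: g)
  case (Cons \<beta> \<beta>s)
  then have "length (step (changes m \<beta>) g) = m" by (simp add: length_step)
  from Cons.IH [OF this] yields_step [OF Cons.prems, of \<beta> \<beta>s] show ?case
    by (simp only: list.map survives.simps)
qed (simp add: alive_0_iff)

text \<open>Of the two signs at one offset, a path that keeps its offset in the next row turns one into
  \<open>+\<close> and the other into \<open>-\<close>. So a row lowers the sum of the two needs by at most one,
  and needs with a sum beyond the number of remaining rows cannot be met.\<close>
lemma alive_scan: "length d = length g \<Longrightarrow> alive n (scan a b d g) \<Longrightarrow> alive (Suc n) g"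
proof (induction g arbitrary: a b d)
  case (Cons x g)
  obtain p q where x: "x = Need p q" by (cases x)
  obtain c ds where d: "d = c # ds" using Cons.prems by (cases d) auto
  have len: "length ds = length g" using Cons.prems by (simp add: d)
  show ?case using Cons.prems(2) Cons.IH [OF len]
    by (cases c) (simp_all add: x d split: if_splits)
qed simp

lemma alive_step: "length d = length g \<Longrightarrow> alive n (step d g) \<Longrightarrow> alive (Suc n) g"
  unfolding step_def by (rule alive_scan)

section \<open>Counting accepted column sign changes\<close>

fun xor :: "bool list \<Rightarrow> bool list \<Rightarrow> bool list" where
  "xor (a # x) (b # y) = (a \<noteq> b) # xor x y"
| "xor _ _ = []"

lemma length_xor [simp]: "length (xor x y) = min (length x) (length y)"
  by (induction x y rule: xor.induct) auto

text \<open>The state before a row consists of the needs and of the bits \<open>x\<close> of this row that are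
  determined by the previous row; the new last bit is free. The next row has the bits of this row, shifted by one
  and corrected by the chessboard letter \<open>L\<close> between the two rows.\<close>
definition advance :: "(need list \<Rightarrow> bool list \<Rightarrow> nat) \<Rightarrow> bool list \<Rightarrow> need list \<Rightarrow> bool list \<Rightarrow> nat" where
  "advance F L g x = F (step (x @ [False]) g) (xor (tl (x @ [False])) L)
                   + F (step (x @ [True]) g) (xor (tl (x @ [True])) L)"

text
  \<open>Behind the last row there is neither a letter nor a bit to correct, and a run is accepted if no need is left.\<close>
fun count :: "bool list list \<Rightarrow> need list \<Rightarrow> bool list \<Rightarrow> nat" where
  "count [] = advance (\<lambda>g x. of_bool (alive 0 g)) []"
| "count (L # w) = advance (count w) L"

text \<open>The rows that a run reads: each is the previous one shifted by one and corrected by a letter, and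
  \<open>bs\<close> supplies the last bits.\<close>
fun windows :: "bool list \<Rightarrow> bool list list \<Rightarrow> bool list \<Rightarrow> bool list list" where
  "windows x w [] = []"
| "windows x [] (b # bs) = [x @ [b]]"
| "windows x (L # w) (b # bs) = (x @ [b]) # windows (xor (tl (x @ [b])) L) w bs"

lemma card_lists_Suc:
  assumes "finite {bs. length bs = n \<and> P (False # bs)}" "finite {bs. length bs = n \<and> P (True # bs)}"
  shows "card {bs. length bs = Suc n \<and> P bs} =
    card {bs. length bs = n \<and> P (False # bs)} + card {bs. length bs = n \<and> P (True # bs)}"
proof -
  have "{bs. length bs = Suc n \<and> P bs} =
      (#) False ` {bs. length bs = n \<and> P (False # bs)} \<union> (#) True ` {bs. length bs = n \<and> P (True # bs)}"
    by (auto simp: length_Suc_conv image_iff) (metis (full_types))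
  moreover have "(#) False ` A \<inter> (#) True ` B = {}" for A B by auto
  ultimately show ?thesis
    using assms by (simp add: card_Un_disjoint card_image inj_on_def)
qed

lemma finite_bool_lists: "finite {bs::bool list. length bs = n \<and> P bs}"
  by (rule finite_subset [OF _ finite_lists_length_eq [of UNIV n]]) auto

lemma count_eq_card:
  "count w g x = card {bs. length bs = Suc (length w) \<and> survives (windows x w bs) g}"
proof (induction w arbitrary: g x)
  case Nil
  have "{bs. bs = [] \<and> Q} = (if Q then {[]} else {})" for Q and bs :: "bool list" by auto
  then show ?case
    by (simp add: card_lists_Suc finite_bool_lists advance_def)
next
  case (Cons L w)
  show ?case
    by (simp add: card_lists_Suc [of "Suc (length w)"] finite_bool_lists advance_def Cons.IH)
qed

text \<open>This allows the exploration to drop dead states.\<close>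
lemma count_eq_0:
  assumes "length g = Suc (length x)" "\<forall>L\<in>set w. length L = length x" "\<not> alive (Suc (length w)) g"
  shows "count w g x = 0"
  using assms
proof (induction w arbitrary: g x)
  case Nil
  then have "\<not> alive 0 (step (x @ [b]) g)" for b
    using alive_step [of "x @ [b]" g 0] by auto
  then show ?case by (simp add: advance_def)
next
  case (Cons L w)
  have "count w (step (x @ [b]) g) (xor (tl (x @ [b])) L) = 0" for b
  proof (rule Cons.IH)
    show "\<not> alive (Suc (length w)) (step (x @ [b]) g)"
      using Cons.prems alive_step [of "x @ [b]" g "Suc (length w)"] by auto
  qed (use Cons.prems in \<open>auto simp: length_step\<close>)
  then show ?case by (simp add: advance_def)
qed

section \<open>Tries of counts\<close>

text
  \<open>Functions from bit lists to natural numbers. A value at an inner position stands for a constant function on all longer lists, and a node ends in its leftmost entry. With these conventions the operations below act entrywise on tries of arbitrary shape.\<close>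
datatype trie = Zero | Val num | Node trie trie

fun entry :: "trie \<Rightarrow> bool list \<Rightarrow> nat" where
  "entry Zero p = 0"
| "entry (Val a) p = numeral a"
| "entry (Node l r) [] = entry l []"
| "entry (Node l r) (b # p) = entry (if b then r else l) p"

fun lookup :: "trie \<Rightarrow> bool list \<Rightarrow> trie" where
  "lookup Zero p = Zero"
| "lookup (Val a) p = Val a"
| "lookup (Node l r) [] = Node l r"
| "lookup (Node l r) (False # p) = lookup l p"
| "lookup (Node l r) (True # p) = lookup r p"

lemma entry_lookup: "entry (lookup t p) q = entry t (p @ q)"
  by (induction t p rule: lookup.induct) auto

fun lookup_xor :: "trie \<Rightarrow> bool list \<Rightarrow> bool list \<Rightarrow> trie" where
  "lookup_xor Zero p q = Zero"
| "lookup_xor (Val a) p q = Val a"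
| "lookup_xor (Node l r) (False # p) (False # q) = lookup_xor l p q"
| "lookup_xor (Node l r) (True # p) (False # q) = lookup_xor r p q"
| "lookup_xor (Node l r) (False # p) (True # q) = lookup_xor r p q"
| "lookup_xor (Node l r) (True # p) (True # q) = lookup_xor l p q"
| "lookup_xor (Node l r) _ _ = Node l r"

lemma entry_lookup_xor: "length p = length q \<Longrightarrow> entry (lookup_xor t p q) [] = entry t (xor p q)"
  by (induction t p q rule: lookup_xor.induct) auto

fun node :: "trie \<Rightarrow> trie \<Rightarrow> trie" where
  "node Zero Zero = Zero"
| "node l r = Node l r"

lemma entry_node: "entry (node l r) p = entry (Node l r) p"
  by (cases "(l, r)" rule: node.cases; cases p) auto

fun plus_trie :: "trie \<Rightarrow> trie \<Rightarrow> trie" where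
  "plus_trie Zero t = t"
| "plus_trie (Val a) Zero = Val a"
| "plus_trie (Val a) (Val b) = Val (a + b)"
| "plus_trie (Val a) (Node s t) = Node (plus_trie (Val a) s) (plus_trie (Val a) t)"
| "plus_trie (Node l r) Zero = Node l r"
| "plus_trie (Node l r) (Val b) = Node (plus_trie l (Val b)) (plus_trie r (Val b))"
| "plus_trie (Node l r) (Node s t) = Node (plus_trie l s) (plus_trie r t)"

lemma entry_plus_trie: "entry (plus_trie s t) p = entry s p + entry t p"
proof (induction s t arbitrary: p rule: plus_trie.induct)
  case (4 a s t) then show ?case by (cases p) auto
next
  case (6 l r b) then show ?case by (cases p) auto
next
  case (7 l r s t) then show ?case by (cases p) auto
qed auto

fun max_trie :: "trie \<Rightarrow> trie \<Rightarrow> trie" where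
  "max_trie Zero t = t"
| "max_trie (Val a) Zero = Val a"
| "max_trie (Val a) (Val b) = (if a \<le> b then Val b else Val a)"
| "max_trie (Val a) (Node s t) = Node (max_trie (Val a) s) (max_trie (Val a) t)"
| "max_trie (Node l r) Zero = Node l r"
| "max_trie (Node l r) (Val b) = Node (max_trie l (Val b)) (max_trie r (Val b))"
| "max_trie (Node l r) (Node s t) = Node (max_trie l s) (max_trie r t)"

lemma entry_max_trie: "entry (max_trie s t) p = max (entry s p) (entry t p)"
proof (induction s t arbitrary: p rule: max_trie.induct)
  case (4 a s t) then show ?case by (cases p) auto
next
  case (6 l r b) then show ?case by (cases p) auto
next
  case (7 l r s t) then show ?case by (cases p) auto
qed (auto simp: max_def)

fun total :: "nat \<Rightarrow> trie \<Rightarrow> trie" where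
  "total 0 u = u"
| "total (Suc n) (Node l r) = plus_trie (total n l) (total n r)"
| "total (Suc n) u = plus_trie (total n u) (total n u)"

lemma sum_lists_Suc:
  "(\<Sum>x | length x = Suc n. f x) = (\<Sum>x | length x = n. f (False # x)) + (\<Sum>x | length x = n. f (True # x))"
  for f :: "bool list \<Rightarrow> nat"
proof -
  have "{x::bool list. length x = Suc n} = (#) False ` {x. length x = n} \<union> (#) True ` {x. length x = n}"
    by (auto simp: length_Suc_conv image_iff)
  moreover have "(#) False ` A \<inter> (#) True ` B = {}" for A B by auto
  moreover have "finite {x::bool list. length x = n}" using finite_bool_lists [of n "\<lambda>_. True"] by simp
  ultimately show ?thesis by (simp add: sum.union_disjoint sum.reindex inj_on_def)
qed

text \<open>A trie over a block of \<open>n\<close> bits is summed into a single value.\<close>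
lemma entry_total: "entry (total n u) [] = (\<Sum>x | length x = n. entry u x)"
  by (induction n u rule: total.induct) (simp_all add: sum_lists_Suc entry_plus_trie del: sum_constant)

section \<open>Extending a word by one letter\<close>

text \<open>A plan has the shape of the trie of a row. Its leaves list the positions in the trie of the next row
  whose values are to be added: a position is the name of the needs in the next row and the bits \<open>x\<close>,
  which still have to be corrected by the letter. The plan depends only on the row, so the automaton is evaluated
  once for all words.\<close>
datatype plan = Skip | One "bool list" "bool list" | Two "bool list" "bool list" "bool list" "bool list" | Fork plan plan

fun fork :: "plan \<Rightarrow> plan \<Rightarrow> plan" where
  "fork Skip Skip = Skip"
| "fork s t = Fork s t"

fun pull :: "plan \<Rightarrow> trie \<Rightarrow> bool list \<Rightarrow> trie" where
  "pull Skip u L = Zero"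
| "pull (One p x) u L = lookup_xor (lookup u p) x L"
| "pull (Two p x q y) u L = plus_trie (lookup_xor (lookup u p) x L) (lookup_xor (lookup u q) y L)"
| "pull (Fork s t) u L = node (pull s u L) (pull t u L)"

lemma entry_pull_fork: "entry (pull (fork s t) u L) (b # p) = entry (pull (if b then t else s) u L) p"
  by (cases "(s, t)" rule: fork.cases) (auto simp: entry_node)

text \<open>The needs that occur before a row are named by their positions in a trie.\<close>
type_synonym names = "(need list \<times> bool list) list"

definition name :: "nat \<Rightarrow> names \<Rightarrow> need list \<Rightarrow> bool list option" where
  "name n N g = (if alive n g then map_of N g else None)"

fun fetch :: "bool list option \<Rightarrow> bool list \<Rightarrow> bool list option \<Rightarrow> bool list \<Rightarrow> plan" where
  "fetch None x None y = Skip"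
| "fetch (Some p) x None y = One p x"
| "fetch None x (Some q) y = One q y"
| "fetch (Some p) x (Some q) y = Two p x q y"

fun block :: "nat \<Rightarrow> names \<Rightarrow> need list \<Rightarrow> bool list \<Rightarrow> nat \<Rightarrow> plan" where
  "block n N g x 0 = fetch (name n N (step (x @ [False]) g)) (tl (x @ [False]))
                          (name n N (step (x @ [True]) g)) (tl (x @ [True]))"
| "block n N g x (Suc l) = fork (block n N g (x @ [False]) l) (block n N g (x @ [True]) l)"

fun named_entry :: "trie \<Rightarrow> bool list option \<Rightarrow> bool list \<Rightarrow> nat" where
  "named_entry u None x = 0"
| "named_entry u (Some p) x = entry u (p @ x)"

lemma entry_block:
  "length x = l \<Longrightarrow> length L = length y + l \<Longrightarrow> entry (pull (block n N g y l) u L) x =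
     advance (\<lambda>h. named_entry u (name n N h)) L g (y @ x)"
proof (induction l arbitrary: x y)
  case 0
  have "entry (pull (fetch s x t y) u L) [] = named_entry u s (xor x L) + named_entry u t (xor y L)"
    if "length x = length L" "length y = length L" for s t x y
    using that by (cases "(s, x, t, y)" rule: fetch.cases) (simp_all add: entry_plus_trie entry_lookup_xor entry_lookup)
  then show ?case using 0 by (simp add: advance_def)
next
  case (Suc l)
  obtain b x' where x: "x = b # x'" "length x' = l" using Suc.prems by (cases x) auto
  show ?case using Suc.IH [OF x(2), of "y @ [b]"] Suc.prems
    by (cases b) (simp_all add: x entry_pull_fork)
qed

text
  \<open>A frame assigns these positions. Growing alternates between the two sides, so the names remain short.\<close>
datatype frame = Void | Single "need list" | Join frame frame

fun names :: "frame \<Rightarrow> names" where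
  "names Void = []"
| "names (Single g) = [(g, [])]"
| "names (Join s t) = map (\<lambda>(g, p). (g, False # p)) (names s) @ map (\<lambda>(g, p). (g, True # p)) (names t)"

fun grow :: "need list \<Rightarrow> frame \<Rightarrow> frame" where
  "grow g Void = Single g"
| "grow g (Single h) = Join (Single g) (Single h)"
| "grow g (Join s t) = Join (grow g t) s"

lemma fst_names_Join: "fst ` set (names (Join s t)) = fst ` set (names s) \<union> fst ` set (names t)"
  by (force simp: image_Un image_image split_beta)

lemma fst_names_grow: "fst ` set (names (grow g t)) = insert g (fst ` set (names t))"
  by (induction g t rule: grow.induct) (auto simp del: names.simps(3) simp: fst_names_Join)

lemma fst_names_fold_grow: "fst ` set (names (fold grow gs t)) = set gs \<union> fst ` set (names t)"
  by (induction gs arbitrary: t) (simp_all add: fst_names_grow)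

fun table :: "nat \<Rightarrow> names \<Rightarrow> nat \<Rightarrow> frame \<Rightarrow> plan" where
  "table n N l Void = Skip"
| "table n N l (Single g) = block n N g [] l"
| "table n N l (Join s t) = fork (table n N l s) (table n N l t)"

lemma entry_table:
  "(g, p) \<in> set (names G) \<Longrightarrow>
    entry (pull (table n N l G) u L) (p @ x) = entry (pull (block n N g [] l) u L) x"
  by (induction G arbitrary: p) (auto simp: entry_pull_fork)

text \<open>The relation \<open>R\<close> is equality for regular words and \<open>\<le>\<close> for irregular
  ones, for which only an upper bound is kept.\<close>
definition represents :: "(nat \<Rightarrow> nat \<Rightarrow> bool) \<Rightarrow> nat \<Rightarrow> names \<Rightarrow> trie \<Rightarrow> (need list \<Rightarrow> bool list \<Rightarrow> nat) \<Rightarrow> bool" where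
  "represents R l N u F \<longleftrightarrow> (\<forall>(g, p)\<in>set N. \<forall>x. length x = l \<longrightarrow> R (F g x) (entry u (p @ x)))"

lemma represents_pull:
  assumes R: "R = (=) \<or> R = (\<le>)" and u: "represents R l N u F"
    and dead: "\<And>h x. length h = Suc l \<Longrightarrow> length x = l \<Longrightarrow> \<not> alive n h \<Longrightarrow> F h x = 0"
    and closed: "\<And>g d. g \<in> fst ` set (names G) \<Longrightarrow> length d = Suc l \<Longrightarrow> alive n (step d g) \<Longrightarrow> step d g \<in> fst ` set N"
    and len: "\<And>g. g \<in> fst ` set (names G) \<Longrightarrow> length g = Suc l" and L: "length L = l"
  shows "represents R l (names G) (pull (table n N l G) u L) (advance F L)"
proof -
  have "R (advance F L g x) (entry (pull (table n N l G) u L) (p @ x))"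
    if gp: "(g, p) \<in> set (names G)" and x: "length x = l" for g p x
  proof -
    have g: "g \<in> fst ` set (names G)" using gp by force
    have 1: "R (F h y) (named_entry u (name n N h) y)"
      if h: "h = step (x @ [b]) g" and y: "y = xor (tl (x @ [b])) L" for b h y
    proof (cases "alive n h")
      case True
      then have "h \<in> fst ` set N" using closed [OF g, of "x @ [b]"] x h by simp
      then obtain q where q: "map_of N h = Some q" by (metis map_of_eq_None_iff option.exhaust)
      then have "(h, q) \<in> set N" by (rule map_of_SomeD)
      then show ?thesis using u True q x y L by (auto simp: represents_def name_def)
    next
      case False
      moreover have "length h = Suc l" using len [OF g] x h by (simp add: length_step)
      ultimately show ?thesis using dead [of h y] R x y L by (auto simp: name_def)
    qed
    have add: "R a b \<Longrightarrow> R c d \<Longrightarrow> R (a + c) (b + d)" for a b c d using R by auto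
    have "entry (pull (table n N l G) u L) (p @ x) = advance (\<lambda>h. named_entry u (name n N h)) L g x"
      using entry_table [OF gp] entry_block [of x l L "[]"] x L by simp
    then show ?thesis using add [OF 1 1] by (simp add: advance_def)
  qed
  then show ?thesis by (auto simp: represents_def)
qed

section \<open>Exploring all words\<close>

definition words :: "nat \<Rightarrow> nat \<Rightarrow> bool list list set" where
  "words l n = {w. length w = n \<and> (\<forall>L\<in>set w. length L = l)}"

lemma words_Suc: "w \<in> words l (Suc n) \<longleftrightarrow> (\<exists>L w'. w = L # w' \<and> length L = l \<and> w' \<in> words l n)"
  by (auto simp: words_def length_Suc_conv)

fun compat :: "bool list \<Rightarrow> bool list list \<Rightarrow> bool" where
  "compat L [] \<longleftrightarrow> True"
| "compat L (K # w) \<longleftrightarrow> tl L = butlast K"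

text \<open>The last \<open>l - 1\<close> squares of a letter and the first \<open>l - 1\<close> squares of the
  next letter lie in the same columns of the chessboard, so a word is regular if all columns of the chessboard are
  constant on the squares that count.\<close>
fun regular :: "bool list list \<Rightarrow> bool" where
  "regular [] \<longleftrightarrow> True"
| "regular (L # w) \<longleftrightarrow> compat L w \<and> regular w"

fun bits :: "nat \<Rightarrow> bool list list" where
  "bits 0 = [[]]"
| "bits (Suc n) = map ((#) False) (bits n) @ map ((#) True) (bits n)"

lemma set_bits: "set (bits n) = {x. length x = n}"
  by (induction n) (auto simp: length_Suc_conv)

text
  \<open>Clusters are numbered in the order of their creation, so a number beyond the last one opens a new cluster.\<close>
fun absorb :: "nat \<Rightarrow> trie \<Rightarrow> trie list \<Rightarrow> trie list" where
  "absorb i u [] = [u]"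
| "absorb 0 u (v # vs) = max_trie u v # vs"
| "absorb (Suc i) u (v # vs) = v # absorb i u vs"

text
  \<open>Regular words of one length are represented by the exact function and the first letter of the word, irregular words by a cluster that bounds their functions.\<close>
datatype known = Known "(bool list list \<times> trie) list" "trie list"

fun enter :: "nat \<Rightarrow> bool list \<Rightarrow> bool list list option \<Rightarrow> trie \<Rightarrow> known \<Rightarrow> known" where
  "enter i L None u (Known rs vs) = Known rs (absorb i u vs)"
| "enter i L (Some t) u (Known rs vs) = (if compat L t
     then if List.member rs ([L], u) then Known rs vs else Known (rs @ [([L], u)]) vs
     else Known rs (absorb i u vs))"

fun first :: "'a \<Rightarrow> 'a list \<Rightarrow> 'a" where
  "first z [] = z"
| "first z (x # xs) = x"

text \<open>The list \<open>is\<close> proposes a cluster for each letter, to be used if the extension is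
  irregular. A bad proposal cannot lead to a wrong bound, only to one that is too weak.\<close>
fun by_letter :: "plan \<Rightarrow> bool list list option \<Rightarrow> trie \<Rightarrow> bool list list \<Rightarrow> nat list \<Rightarrow> known \<Rightarrow> known" where
  "by_letter T tag u [] is K = K"
| "by_letter T tag u (L # Ls) is K =
     by_letter T tag u Ls (tl is) (enter (first 0 is) L tag (pull T u L) K)"

type_synonym item = "bool list list option \<times> trie"

fun expand :: "plan \<Rightarrow> bool list list \<Rightarrow> item list \<Rightarrow> nat list list \<Rightarrow> known \<Rightarrow> known" where
  "expand T Ls [] hs K = K"
| "expand T Ls ((tag, u) # us) hs K = expand T Ls us (tl hs) (by_letter T tag u Ls (first [] hs) K)"

fun items :: "known \<Rightarrow> item list" where
  "items (Known rs vs) = map (\<lambda>(t, u). (Some t, u)) rs @ map (\<lambda>u. (None, u)) vs"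

definition bounded_by :: "trie \<Rightarrow> trie \<Rightarrow> bool" where
  "bounded_by s t \<longleftrightarrow> (\<forall>p. entry s p \<le> entry t p)"

text \<open>What the exploration must have recorded about the extension by \<open>L\<close>: the function itself
  if the extension is regular, a bound otherwise.\<close>
fun admits :: "known \<Rightarrow> bool list list option \<Rightarrow> bool list \<Rightarrow> trie \<Rightarrow> bool" where
  "admits (Known rs vs) tag L u \<longleftrightarrow>
     (if \<exists>t. tag = Some t \<and> compat L t then ([L], u) \<in> set rs else \<exists>v\<in>set vs. bounded_by u v)"

lemma absorb_bounds: "\<exists>v\<in>set (absorb i u vs). bounded_by u v"
  by (induction i u vs rule: absorb.induct) (auto simp: bounded_by_def entry_max_trie)

lemma absorb_mono: "w \<in> set vs \<Longrightarrow> bounded_by s w \<Longrightarrow> \<exists>v\<in>set (absorb i u vs). bounded_by s v"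
  by (induction i u vs rule: absorb.induct) (auto simp: bounded_by_def entry_max_trie intro: le_max_iff_disj [THEN iffD2])

lemma admits_enter: "admits (enter i L tag u K) tag L u"
  by (cases K; cases tag) (auto simp: absorb_bounds)

lemma admits_enter_mono: "admits K tag' L' u' \<Longrightarrow> admits (enter i L tag u K) tag' L' u'"
  by (cases K; cases tag) (auto intro: absorb_mono split: if_splits)

lemma admits_by_letter_mono: "admits K tag' L' u' \<Longrightarrow> admits (by_letter T tag u Ls is K) tag' L' u'"
  by (induction Ls arbitrary: "is" K) (simp_all add: admits_enter_mono)

lemma admits_by_letter: "L \<in> set Ls \<Longrightarrow> admits (by_letter T tag u Ls is K) tag L (pull T u L)"
  by (induction Ls arbitrary: "is" K) (auto simp: admits_enter admits_by_letter_mono)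

lemma admits_expand_mono: "admits K tag L u \<Longrightarrow> admits (expand T Ls us hs K) tag L u"
  by (induction us arbitrary: hs K) (auto simp: admits_by_letter_mono)

lemma admits_expand:
  "(tag, u) \<in> set us \<Longrightarrow> L \<in> set Ls \<Longrightarrow> admits (expand T Ls us hs K) tag L (pull T u L)"
  by (induction us arbitrary: hs K) (auto simp: admits_by_letter admits_expand_mono)

lemma items_admits:
  assumes "admits K tag L u"
  shows "if \<exists>t. tag = Some t \<and> compat L t then (Some [L], u) \<in> set (items K)
    else \<exists>v. (None, v) \<in> set (items K) \<and> bounded_by u v"
  using assms by (cases K) (force split: if_splits)

text \<open>The invariant of the exploration: every word of length \<open>n\<close> is represented in the sense
  of \<open>known\<close>. The list \<open>take 1 w\<close> is the first letter of \<open>w\<close>, if any;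
  nothing else of a regular word matters for its regular extensions.\<close>
definition covers :: "nat \<Rightarrow> names \<Rightarrow> nat \<Rightarrow> item list \<Rightarrow> bool" where
  "covers l N n us \<longleftrightarrow> (\<forall>w\<in>words l n. if regular w
     then \<exists>u. (Some (take 1 w), u) \<in> set us \<and> represents (=) l N u (count w)
     else \<exists>u. (None, u) \<in> set us \<and> represents (\<le>) l N u (count w))"

lemma compat_take: "compat L (take (Suc 0) w) \<longleftrightarrow> compat L w"
  by (cases w) auto

lemma represents_bounded: "represents R l N u F \<Longrightarrow> R = (=) \<or> R = (\<le>) \<Longrightarrow> bounded_by u v \<Longrightarrow> represents (\<le>) l N v F"
  unfolding represents_def bounded_by_def by (fastforce intro: le_trans)

definition reached :: "nat \<Rightarrow> bool list list \<Rightarrow> names \<Rightarrow> need list list" where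
  "reached n ds N = List.union (filter (alive n) (concat (map (\<lambda>(g, p). map (\<lambda>d. step d g) ds) N))) []"

lemma set_reached: "set (reached n ds N) = {step d g | d g. d \<in> set ds \<and> g \<in> fst ` set N \<and> alive n (step d g)}"
  by (force simp: reached_def)

fun plans :: "bool list list \<Rightarrow> nat \<Rightarrow> nat \<Rightarrow> frame \<Rightarrow> plan list"
  and plans_from :: "bool list list \<Rightarrow> nat \<Rightarrow> nat \<Rightarrow> frame \<Rightarrow> frame \<Rightarrow> plan list" where
  "plans ds l 0 G = []"
| "plans ds l (Suc n) G = plans_from ds l n G (fold grow (reached n ds (names G)) Void)"
| "plans_from ds l n G H = table n (names H) l G # plans ds l n H"

text \<open>Behind the last row, the only needs that are alive are those that vanish, so the function to start
  from is the constant \<open>1\<close>; being constant, it is the same for every letter.\<close>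
fun solve :: "bool list list \<Rightarrow> plan list \<Rightarrow> nat list list list \<Rightarrow> item list" where
  "solve Ls [] hs = []"
| "solve Ls [T] hs = [(Some [], pull T (Val num.One) (hd Ls))]"
| "solve Ls (T # T' # Ts) hs = items (expand T Ls (solve Ls (T' # Ts) (tl hs)) (first [] hs) (Known [] []))"

text \<open>Only needs that are alive are named; by \<open>count_eq_0\<close> the others contribute
  nothing.\<close>
lemma successor_frame:
  fixes G n l
  defines "H \<equiv> fold grow (reached n (bits (Suc l)) (names G)) Void"
  assumes "\<forall>g\<in>fst ` set (names G). length g = Suc l"
  shows "\<And>g. g \<in> fst ` set (names H) \<Longrightarrow> length g = Suc l"
    and "\<And>g. g \<in> fst ` set (names H) \<Longrightarrow> alive n g"
    and "\<And>g d. g \<in> fst ` set (names G) \<Longrightarrow> length d = Suc l \<Longrightarrow> alive n (step d g) \<Longrightarrow> step d g \<in> fst ` set (names H)"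
proof -
  have "fst ` set (names H) = {step d g | d g. d \<in> set (bits (Suc l)) \<and> g \<in> fst ` set (names G) \<and> alive n (step d g)}"
    by (simp add: H_def fst_names_fold_grow set_reached)
  then have H: "h \<in> fst ` set (names H) \<longleftrightarrow>
      (\<exists>d g. h = step d g \<and> length d = Suc l \<and> g \<in> fst ` set (names G) \<and> alive n h)" for h
    unfolding set_bits by auto
  show "\<And>g. g \<in> fst ` set (names H) \<Longrightarrow> length g = Suc l"
    unfolding H using assms(2) length_step by fastforce
  show "\<And>g. g \<in> fst ` set (names H) \<Longrightarrow> alive n g"
    unfolding H by blast
  show "\<And>g d. g \<in> fst ` set (names G) \<Longrightarrow> length d = Suc l \<Longrightarrow> alive n (step d g) \<Longrightarrow> step d g \<in> fst ` set (names H)"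
    unfolding H by blast
qed

lemma solve_covers:
  "\<forall>g\<in>fst ` set (names G). length g = Suc l \<Longrightarrow>
    covers l (names G) n (solve (bits l) (plans (bits (Suc l)) l (Suc n) G) hs)"
proof (induction n arbitrary: G hs)
  case 0
  define H where "H = fold grow (reached 0 (bits (Suc l)) (names G)) Void"
  note H = successor_frame [where G = G and l = l and n = 0, folded H_def, OF 0]
  have "bits l \<noteq> []" by (induction l) auto
  then have "hd (bits l) \<in> set (bits l)" by (rule hd_in_set)
  then have hd: "length (hd (bits l)) = l" by (simp add: set_bits)
  have "represents (=) l (names H) (Val num.One) (\<lambda>g x. of_bool (alive 0 g))"
    unfolding represents_def
  proof (intro ballI, clarify)
    fix g p x assume "(g, p) \<in> set (names H)"
    then have "fst (g, p) \<in> fst ` set (names H)" by (rule imageI)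
    then have "alive 0 g" using H(2) [of "fst (g, p)"] by (simp only: fst_conv)
    then show "of_bool (alive 0 g) = entry (Val num.One) (p @ x)" by simp
  qed
  then have "represents (=) l (names G) (pull (table 0 (names H) l G) (Val num.One) (hd (bits l)))
      (advance (\<lambda>g x. of_bool (alive 0 g)) (hd (bits l)))"
    by (rule represents_pull [rotated]) (use H 0 hd in auto)
  moreover have "advance (\<lambda>g x. of_bool (alive 0 g)) (hd (bits l)) = count []"
    by (intro ext) (simp add: advance_def)
  ultimately show ?case by (simp add: covers_def words_def H_def)
next
  case (Suc n)
  define H where "H = fold grow (reached (Suc n) (bits (Suc l)) (names G)) Void"
  note H = successor_frame [where G = G and l = l and n = "Suc n", folded H_def, OF Suc.prems]
  define T where "T = table (Suc n) (names H) l G"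
  define us where "us = solve (bits l) (plans (bits (Suc l)) l (Suc n) H) (tl hs)"
  define K where "K = expand T (bits l) us (first [] hs) (Known [] [])"
  have "plans (bits (Suc l)) l (Suc (Suc n)) G = T # plans (bits (Suc l)) l (Suc n) H"
    by (simp add: T_def H_def)
  then have solve: "solve (bits l) (plans (bits (Suc l)) l (Suc (Suc n)) G) hs = items K"
    by (simp add: K_def us_def)
  have us: "covers l (names H) n us" unfolding us_def by (rule Suc.IH) (use H(1) in blast)
  have pull: "represents R l (names G) (pull T u L) (count (L # w))"
    if "R = (=) \<or> R = (\<le>)" "represents R l (names H) u (count w)" "w \<in> words l n" "length L = l" for R u L w
    unfolding T_def count.simps
    by (rule represents_pull [OF that(1,2)]) (use that H Suc.prems in \<open>auto simp: words_def count_eq_0\<close>)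
  have "if regular w then \<exists>u. (Some (take 1 w), u) \<in> set (items K) \<and> represents (=) l (names G) u (count w)
     else \<exists>u. (None, u) \<in> set (items K) \<and> represents (\<le>) l (names G) u (count w)"
    if w_in: "w \<in> words l (Suc n)" for w
  proof -
    obtain L w' where w: "w = L # w'" and w': "w' \<in> words l n" and L: "length L = l"
      using w_in unfolding words_Suc by blast
    have adm: "(tag, u) \<in> set us \<Longrightarrow> admits K tag L (pull T u L)" for tag u
      unfolding K_def by (rule admits_expand) (auto simp: set_bits L)
    show ?thesis
    proof (cases "regular w'")
      case True
      then obtain u where u: "(Some (take 1 w'), u) \<in> set us" "represents (=) l (names H) u (count w')"
        using bspec [OF us [unfolded covers_def] w'] True by (auto simp del: One_nat_def)
      show ?thesis
        using items_admits [OF adm [OF u(1)]] pull [OF _ u(2) w' L] True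
        by (auto simp: w compat_take intro: represents_bounded split: if_splits)
    next
      case False
      then obtain u where u: "(None, u) \<in> set us" "represents (\<le>) l (names H) u (count w')"
        using bspec [OF us [unfolded covers_def] w'] False by (auto simp del: One_nat_def)
      show ?thesis
        using items_admits [OF adm [OF u(1)]] pull [OF _ u(2) w' L] False
        by (auto simp: w intro: represents_bounded)
    qed
  qed
  then show ?case unfolding covers_def solve by blast
qed

fun below :: "num \<Rightarrow> trie \<Rightarrow> bool" where
  "below c Zero \<longleftrightarrow> True"
| "below c (Val a) \<longleftrightarrow> a < c"
| "below c (Node l r) \<longleftrightarrow> False"

fun settled :: "num \<Rightarrow> bool list list option \<Rightarrow> bool list \<Rightarrow> trie \<Rightarrow> bool" where
  "settled c None L v \<longleftrightarrow> below c v"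
| "settled c (Some t) L v \<longleftrightarrow> (if compat L t then v = Val c else below c v)"

text \<open>The extensions by the first letter of the word are not merged any more. Each of them is summed over
  the free bits \<open>x\<close> of the first row and compared with the target.\<close>
definition verified :: "num \<Rightarrow> nat \<Rightarrow> nat \<Rightarrow> frame \<Rightarrow> nat list list list \<Rightarrow> bool" where
  "verified c l n G hs \<longleftrightarrow> (case plans (bits (Suc l)) l n G of
     [] \<Rightarrow> False
   | T # Ts \<Rightarrow> list_all (\<lambda>(tag, u). list_all (\<lambda>L. settled c tag L (total l (pull T u L))) (bits l))
       (solve (bits l) Ts hs))"

lemma below_less: "below c v \<Longrightarrow> entry v [] < numeral c"
  by (cases v) auto

lemma verified_count:
  assumes ver: "verified c l (Suc (Suc n)) (Single g) hs" and g: "length g = Suc l" and w: "w \<in> words l (Suc n)"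
  shows "if regular w then (\<Sum>x | length x = l. count w g x) = numeral c
    else (\<Sum>x | length x = l. count w g x) < numeral c"
proof -
  let ?G = "Single g"
  define H where "H = fold grow (reached (Suc n) (bits (Suc l)) (names ?G)) Void"
  have G: "\<forall>h\<in>fst ` set (names ?G). length h = Suc l" using g by simp
  note H = successor_frame [where G = ?G and l = l and n = "Suc n", folded H_def, OF G]
  define T where "T = table (Suc n) (names H) l ?G"
  define us where "us = solve (bits l) (plans (bits (Suc l)) l (Suc n) H) hs"
  have "plans (bits (Suc l)) l (Suc (Suc n)) ?G = T # plans (bits (Suc l)) l (Suc n) H"
    by (simp add: T_def H_def)
  then have ver: "settled c tag L (total l (pull T u L))" if "(tag, u) \<in> set us" "length L = l" for tag u L
    using ver that by (auto simp: verified_def us_def list_all_iff set_bits simp del: plans.simps)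
  have us: "covers l (names H) n us" unfolding us_def by (rule solve_covers) (use H(1) in blast)
  obtain L w' where w: "w = L # w'" and w': "w' \<in> words l n" and L: "length L = l"
    using w unfolding words_Suc by blast
  have pull: "R (\<Sum>x | length x = l. count w g x) (entry (total l (pull T u L)) [])"
    if R: "R = (=) \<or> R = (\<le>)" and u: "represents R l (names H) u (count w')" for R u
  proof -
    have "represents R l (names ?G) (pull T u L) (count w)"
      unfolding T_def count.simps w
    proof (rule represents_pull [OF R u])
      show "count w' h x = 0" if "length h = Suc l" "length x = l" "\<not> alive (Suc n) h" for h x
        using that w' by (auto simp: words_def intro!: count_eq_0)
      show "step d h \<in> fst ` set (names H)"
        if "h \<in> fst ` set (names ?G)" "length d = Suc l" "alive (Suc n) (step d h)" for h d
        using that by (rule H(3))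
    qed (use G L in blast)+
    then have "R (count w g x) (entry (pull T u L) x)" if "length x = l" for x
      using that by (simp add: represents_def)
    then show ?thesis using R unfolding entry_total by (auto intro: sum.cong sum_mono)
  qed
  show ?thesis
  proof (cases "regular w'")
    case True
    then obtain u where u: "(Some (take 1 w'), u) \<in> set us" "represents (=) l (names H) u (count w')"
      using bspec [OF us [unfolded covers_def] w'] True by (auto simp del: One_nat_def)
    show ?thesis
      using ver [OF u(1) L] pull [OF _ u(2)] True below_less
      by (fastforce simp: w compat_take split: if_splits)
  next
    case False
    then obtain u where u: "(None, u) \<in> set us" "represents (\<le>) l (names H) u (count w')"
      using bspec [OF us [unfolded covers_def] w'] False by (auto simp del: One_nat_def)
    show ?thesis
      using ver [OF u(1) L] pull [OF _ u(2)] False below_less by (fastforce simp: w intro: le_less_trans)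
  qed
qed

section \<open>Circuits of Lawrence oriented matroids as paths\<close>

text \<open>The recurrence of \<open>circuits_lawrence_om\<close> along a support, from row \<open>i\<close> on;
  \<open>True\<close> stands for \<open>+\<close>.\<close>
fun signs :: "(nat \<Rightarrow> nat \<Rightarrow> int) \<Rightarrow> nat \<Rightarrow> bool \<Rightarrow> nat list \<Rightarrow> bool list" where
  "signs A i Y [] = []"
| "signs A i Y [j] = [Y]"
| "signs A i Y (j # j' # js) = Y # signs A (Suc i) (Y \<noteq> (A i j = A i j')) (j' # js)"

lemma length_signs [simp]: "length (signs A i Y js) = length js"
  by (induction A i Y js rule: signs.induct) auto

lemma signs_Cons: "signs A i Y (j # js) = Y # tl (signs A i Y (j # js))"
  by (cases js) auto

lemma signs_nth_0: "js \<noteq> [] \<Longrightarrow> signs A i Y js ! 0 = Y"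
  by (cases js) (simp, metis nth_Cons_0 signs_Cons)

lemma signs_nth_Suc:
  "Suc p < length js \<Longrightarrow> signs A i Y js ! Suc p =
     (signs A i Y js ! p \<noteq> (A (i + p) (js ! p) = A (i + p) (js ! Suc p)))"
proof (induction A i Y js arbitrary: p rule: signs.induct)
  case (3 A i Y j j' js)
  show ?case
  proof (cases p)
    case 0
    then show ?thesis using signs_nth_0 [of "j' # js" A "Suc i"] by simp
  next
    case (Suc q)
    then show ?thesis using 3 by simp
  qed
qed auto

lemma signs_Not: "signs A i (\<not> Y) js = map Not (signs A i Y js)"
proof (induction A i Y js rule: signs.induct)
  case (3 A i Y j j' js)
  then show ?case by (cases "A i j = A i j'") auto
qed auto

definition vector_of :: "nat list \<Rightarrow> bool list \<Rightarrow> nat \<Rightarrow> int" where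
  "vector_of js ys j = (case map_of (zip js ys) j of None \<Rightarrow> 0 | Some b \<Rightarrow> if b then 1 else - 1)"

lemma vector_of_nth:
  "distinct js \<Longrightarrow> length ys = length js \<Longrightarrow> p < length js \<Longrightarrow>
    vector_of js ys (js ! p) = (if ys ! p then 1 else - 1)"
  by (simp add: vector_of_def map_of_zip_nth)

lemma vector_of_outside: "length ys = length js \<Longrightarrow> j \<notin> set js \<Longrightarrow> vector_of js ys j = 0"
  by (auto simp: vector_of_def map_of_eq_None_iff split: option.splits dest: map_of_SomeD set_zip_leftD)

lemma vector_of_eqI:
  assumes "distinct js" "length ys = length js"
    and "\<And>p. p < length js \<Longrightarrow> X (js ! p) = (if ys ! p then 1 else - 1)"
    and "\<And>j. j \<notin> set js \<Longrightarrow> X j = 0"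
  shows "X = vector_of js ys"
proof
  fix j show "X j = vector_of js ys j"
    using assms by (cases "j \<in> set js") (auto simp: in_set_conv_nth vector_of_nth vector_of_outside)
qed

lemma
  assumes "distinct js" "length ys = length js"
  shows pos_vector_of: "pos (vector_of js ys) = (!) js ` {p. p < length js \<and> ys ! p}"
    and neg_vector_of: "neg (vector_of js ys) = (!) js ` {p. p < length js \<and> \<not> ys ! p}"
proof -
  have *: "vector_of js ys j = s \<longleftrightarrow> (\<exists>p<length js. j = js ! p \<and> (if ys ! p then 1 else - 1) = s)"
    if "s \<noteq> 0" for s j
    using assms that vector_of_outside [of ys js j]
    by (cases "j \<in> set js") (auto simp: in_set_conv_nth vector_of_nth)
  show "pos (vector_of js ys) = (!) js ` {p. p < length js \<and> ys ! p}"
    "neg (vector_of js ys) = (!) js ` {p. p < length js \<and> \<not> ys ! p}"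
    by (auto simp: pos_def neg_def * split: if_splits)
qed

lemma
  assumes "distinct js" "length ys = length js"
  shows card_pos_vector_of: "card (pos (vector_of js ys)) = length (filter id ys)"
    and card_neg_vector_of: "card (neg (vector_of js ys)) = length (filter Not ys)"
    and supp_vector_of: "supp (vector_of js ys) = set js"
proof -
  have inj: "inj_on ((!) js) {p. p < length js \<and> P p}" for P
    using assms(1) by (auto simp: inj_on_def nth_eq_iff_index_eq)
  show "card (pos (vector_of js ys)) = length (filter id ys)"
    "card (neg (vector_of js ys)) = length (filter Not ys)"
    by (simp_all add: pos_vector_of [OF assms] neg_vector_of [OF assms] card_image inj length_filter_conv_card assms(2))
  show "supp (vector_of js ys) = set js"
    unfolding supp_def pos_vector_of [OF assms] neg_vector_of [OF assms] set_conv_nth by blast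
qed

definition supports :: "nat \<Rightarrow> nat \<Rightarrow> nat list \<Rightarrow> bool" where
  "supports r n js \<longleftrightarrow> sorted_wrt (<) js \<and> length js = Suc r \<and> set js \<subseteq> {1..n}"

lemma circuit_nth:
  assumes A: "sign_matrix r n A" and js: "supports r n js" and X: "X = vector_of js ys" "length ys = Suc r"
  shows "X \<in> circuits (lawrence_om r n A) \<longleftrightarrow> ys = signs A 1 (ys ! 0) js"
proof -
  have d: "distinct js" and s: "sorted_list_of_set (set js) = js" and l: "length js = Suc r"
    using js by (auto simp: supports_def strict_sorted_iff sorted_list_of_set.idem_if_sorted_distinct)
  note XV = X(1) [symmetric]
  have sv: "X \<in> sign_vectors {1..n}"
  proof -
    have "X e \<in> {-1, 0, 1}" for e by (auto simp: X vector_of_def split: option.splits)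
    moreover have "X e = 0" if "e \<notin> {1..n}" for e
    proof -
      have "e \<notin> set js" using that js by (auto simp: supports_def)
      then show ?thesis using X l by (simp add: vector_of_outside)
    qed
    ultimately show ?thesis by (simp add: sign_vectors_def)
  qed
  have supp: "supp X = set js" and len: "card (supp X) = r + 1"
    using supp_vector_of [OF d, of ys] X l d by (simp_all add: distinct_card)
  have nz: "A (Suc i) (js ! i) \<in> {-1, 1}" "A (Suc i) (js ! Suc i) \<in> {-1, 1}" if "i < r" for i
  proof -
    have "js ! i \<in> {1..n}" "js ! Suc i \<in> {1..n}" "Suc i \<in> {1..r}"
      using that js l nth_mem [of i js] nth_mem [of "Suc i" js] by (auto simp: supports_def simp del: nth_mem)
    then show "A (Suc i) (js ! i) \<in> {-1, 1}" "A (Suc i) (js ! Suc i) \<in> {-1, 1}"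
      using A unfolding sign_matrix_def by blast+
  qed
  have Xp: "X (js ! p) = (if ys ! p then 1 else - 1)" if "p \<le> r" for p
    using vector_of_nth [OF d, of ys p] X l that by simp
  have "X \<in> circuits (lawrence_om r n A) \<longleftrightarrow>
      (\<forall>i<r. X (js ! Suc i) = - X (js ! i) * A (Suc i) (js ! i) * A (Suc i) (js ! Suc i))"
    unfolding circuits_lawrence_om [OF A] using sv len by (simp add: supp s)
  also have "\<dots> \<longleftrightarrow> (\<forall>i<r. ys ! Suc i = (ys ! i \<noteq> (A (Suc i) (js ! i) = A (Suc i) (js ! Suc i))))"
  proof -
    have "(X (js ! Suc i) = - X (js ! i) * A (Suc i) (js ! i) * A (Suc i) (js ! Suc i)) \<longleftrightarrow>
        (ys ! Suc i = (ys ! i \<noteq> (A (Suc i) (js ! i) = A (Suc i) (js ! Suc i))))" if "i < r" for i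
      using nz [OF that] Xp [of i] Xp [of "Suc i"] that by auto
    then show ?thesis by blast
  qed
  also have "\<dots> \<longleftrightarrow> ys = signs A 1 (ys ! 0) js"
  proof
    assume rec: "\<forall>i<r. ys ! Suc i = (ys ! i \<noteq> (A (Suc i) (js ! i) = A (Suc i) (js ! Suc i)))"
    have nth: "p \<le> r \<Longrightarrow> ys ! p = signs A 1 (ys ! 0) js ! p" for p
    proof (induction p)
      case 0
      then show ?case using l signs_nth_0 [of js] by (metis length_0_conv nat.distinct(1))
    next
      case (Suc p)
      then show ?case using rec signs_nth_Suc [of p js A 1 "ys ! 0"] l by simp
    qed
    show "ys = signs A 1 (ys ! 0) js"
    proof (rule nth_equalityI)
      show "ys ! p = signs A 1 (ys ! 0) js ! p" if "p < length ys" for p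
        by (rule nth) (use that X in simp)
    qed (simp add: X l)
  next
    assume eq: "ys = signs A 1 (ys ! 0) js"
    show "\<forall>i<r. ys ! Suc i = (ys ! i \<noteq> (A (Suc i) (js ! i) = A (Suc i) (js ! Suc i)))"
      using signs_nth_Suc [of _ js A 1 "ys ! 0", folded eq] l by simp
  qed
  finally show ?thesis .
qed

lemma circuits_eq_signs:
  assumes A: "sign_matrix r n A"
  shows "circuits (lawrence_om r n A) = {vector_of js (signs A 1 Y js) | js Y. supports r n js}"
proof (intro set_eqI iffI)
  fix X assume X: "X \<in> circuits (lawrence_om r n A)"
  define js where "js = sorted_list_of_set (supp X)"
  define ys where "ys = map (\<lambda>j. X j = 1) js"
  have sv: "X \<in> sign_vectors {1..n}" and card: "card (supp X) = r + 1"
    using X by (auto simp: circuits_lawrence_om [OF A])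
  then have fin: "finite (supp X)" using card.infinite by fastforce
  have set: "set js = supp X" using fin by (simp add: js_def)
  have "supp X \<subseteq> {1..n}" using sv by (auto simp: supp_def pos_def neg_def sign_vectors_def)
  then have js: "supports r n js"
    using card fin by (simp add: supports_def js_def)
  have "X = vector_of js ys"
  proof (rule vector_of_eqI)
    show "distinct js" "length ys = length js" by (simp_all add: js_def ys_def)
    show "X (js ! p) = (if ys ! p then 1 else - 1)" if "p < length js" for p
    proof -
      have "js ! p \<in> supp X" using that set nth_mem by blast
      then show ?thesis using that by (auto simp: ys_def supp_def pos_def neg_def)
    qed
    show "X j = 0" if "j \<notin> set js" for j
    proof -
      have "X j \<in> {-1, 0, 1}" using sv by (cases "j \<in> {1..n}") (auto simp: sign_vectors_def)
      then show ?thesis using that by (auto simp: set supp_def pos_def neg_def)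
    qed
  qed
  moreover have "length ys = Suc r" using js by (simp add: ys_def supports_def)
  ultimately have "X = vector_of js (signs A 1 (ys ! 0) js)"
    using circuit_nth [OF A js, of X ys] X by simp
  then show "X \<in> {vector_of js (signs A 1 Y js) | js Y. supports r n js}"
    using js by blast
next
  fix X assume "X \<in> {vector_of js (signs A 1 Y js) | js Y. supports r n js}"
  then obtain js Y where X: "X = vector_of js (signs A 1 Y js)" and js: "supports r n js" by blast
  have "js \<noteq> []" using js by (auto simp: supports_def)
  then show "X \<in> circuits (lawrence_om r n A)"
    using circuit_nth [OF A js X] js by (simp add: signs_nth_0 supports_def)
qed

text \<open>The negative of a circuit is a circuit, so it suffices to count positive elements.\<close>
lemma neighborly_iff_signs:
  assumes A: "sign_matrix r n A"
  shows "neighborly k (lawrence_om r n A) \<longleftrightarrow>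
    (\<forall>js Y. supports r n js \<longrightarrow> k < length (filter id (signs A 1 Y js)))"
proof -
  have d: "distinct js" if "supports r n js" for js
    using that by (simp add: supports_def strict_sorted_iff)
  have neg: "length (filter Not (signs A 1 Y js)) = length (filter id (signs A 1 (\<not> Y) js))" for js Y
    by (simp add: signs_Not filter_map o_def)
  have "neighborly k (lawrence_om r n A) \<longleftrightarrow> (\<forall>js Y. supports r n js \<longrightarrow>
      k < length (filter id (signs A 1 Y js)) \<and> k < length (filter id (signs A 1 (\<not> Y) js)))"
  proof -
    have "neighborly k (lawrence_om r n A) \<longleftrightarrow> (\<forall>js Y. supports r n js \<longrightarrow>
        card (pos (vector_of js (signs A 1 Y js))) > k \<and> card (neg (vector_of js (signs A 1 Y js))) > k)"
      unfolding neighborly_def circuits_eq_signs [OF A] by blast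
    moreover have "card (pos (vector_of js (signs A 1 Y js))) = length (filter id (signs A 1 Y js))"
      "card (neg (vector_of js (signs A 1 Y js))) = length (filter id (signs A 1 (\<not> Y) js))"
      if "supports r n js" for js Y
      using d [OF that] by (simp_all only: card_pos_vector_of card_neg_vector_of length_signs neg)
    ultimately show ?thesis by simp
  qed
  then show ?thesis by metis
qed

definition row :: "(nat \<Rightarrow> nat \<Rightarrow> int) \<Rightarrow> nat \<Rightarrow> nat \<Rightarrow> bool" where
  "row A i e \<longleftrightarrow> A i (i + e) = 1"

lemma last_ge: "sorted_wrt (<) js \<Longrightarrow> js \<noteq> [] \<Longrightarrow> hd js + length js \<le> Suc (last js)" for js :: "nat list"
proof (induction js)
  case (Cons j js)
  then show ?case by (cases js) auto
qed simp

lemma hd_le_last: "sorted_wrt (<) js \<Longrightarrow> j \<in> set js \<Longrightarrow> hd js \<le> j \<and> j \<le> last js" for js :: "nat list"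
proof (induction js)
  case (Cons a js)
  show ?case
  proof (cases "js = []")
    case False
    then have "a < last js" using Cons.prems by simp
    moreover have "hd js \<le> j \<and> j \<le> last js" if "j \<noteq> a" using Cons that by simp
    moreover have "a < j" if "j \<noteq> a" using Cons.prems that by simp
    ultimately show ?thesis using False by (cases "j = a") auto
  qed (use Cons.prems in simp)
qed simp

text \<open>Offsets are columns relative to the diagonal: the element at position \<open>i - 1\<close> of a
  support is at least \<open>i\<close> and at most \<open>i + m - 1\<close>, because \<open>i - 1\<close> elements
  precede it and \<open>r + 1 - i\<close> follow.\<close>
lemma yields_rows_iff:
  assumes A: "sign_matrix r (r + m) A"
  shows "i + l = Suc r \<Longrightarrow> 1 \<le> i \<Longrightarrow> e < m \<Longrightarrow> yields m (map (row A) [i..<Suc r]) e Y h \<longleftrightarrow>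
    (\<forall>js. sorted_wrt (<) js \<longrightarrow> length js = Suc l \<longrightarrow> hd js = i + e \<longrightarrow> last js \<le> r + m \<longrightarrow>
      h \<le> length (filter id (tl (signs A i Y js))))"
proof (induction l arbitrary: i e Y h)
  case 0
  have "yields m (map (row A) [i..<Suc r]) e Y h \<longleftrightarrow> h = 0" using 0 by simp
  also have "\<dots> \<longleftrightarrow> (\<forall>js. sorted_wrt (<) js \<longrightarrow> length js = Suc 0 \<longrightarrow> hd js = i + e \<longrightarrow> last js \<le> r + m \<longrightarrow>
      h \<le> length (filter id (tl (signs A i Y js))))" (is "_ \<longleftrightarrow> ?r")
  proof
    show ?r if "h = 0" using that by simp
    show "h = 0" if ?r using that [rule_format, of "[i + e]"] 0 by simp
  qed
  finally show ?case .
next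
  case (Suc l)
  define Z where "Z f = (Y \<noteq> (A i (i + e) = A i (i + Suc f)))" for f
  have r: "r = i + l" using Suc.prems by simp
  have eq: "(row A i e = row A i (Suc f)) = (A i (i + e) = A i (i + Suc f))" if "f < m" for f
  proof -
    have "A i j \<in> {-1, 1}" if "i \<le> j" "j \<le> i + m" for j
      using A that Suc.prems(2) r by (auto simp: sign_matrix_def)
    from this [of "i + e"] this [of "i + Suc f"] show ?thesis
      using Suc.prems that by (auto simp: row_def)
  qed
  have upt: "[i..<Suc r] = i # [Suc i..<Suc r]" using r by (simp add: upt_conv_Cons)
  have "yields m (map (row A) [i..<Suc r]) e Y h \<longleftrightarrow>
      (\<forall>f\<in>{e..<m}. yields m (map (row A) [Suc i..<Suc r]) f (Z f) (h - of_bool (Z f)))"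
    unfolding upt by (simp add: eq Z_def)
  also have "\<dots> \<longleftrightarrow> (\<forall>f\<in>{e..<m}. \<forall>js. sorted_wrt (<) js \<longrightarrow> length js = Suc l \<longrightarrow> hd js = Suc i + f \<longrightarrow>
      last js \<le> r + m \<longrightarrow> h - of_bool (Z f) \<le> length (filter id (tl (signs A (Suc i) (Z f) js))))"
    using Suc.prems by (intro ball_cong refl Suc.IH) auto
  also have "\<dots> \<longleftrightarrow> (\<forall>js. sorted_wrt (<) js \<longrightarrow> length js = Suc (Suc l) \<longrightarrow> hd js = i + e \<longrightarrow> last js \<le> r + m \<longrightarrow>
      h \<le> length (filter id (tl (signs A i Y js))))" (is "?l \<longleftrightarrow> ?r")
  proof -
    have tl: "h \<le> length (filter id (tl (signs A i Y ((i + e) # js)))) \<longleftrightarrow>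
        h - of_bool (Z f) \<le> length (filter id (tl (signs A (Suc i) (Z f) js)))"
      if js: "length js = Suc l" "hd js = Suc i + f" for f js
    proof -
      obtain js' where js': "js = (Suc i + f) # js'" using js by (cases js) auto
      have "tl (signs A i Y ((i + e) # js)) = signs A (Suc i) (Z f) js"
        by (simp add: js' Z_def)
      also have "\<dots> = Z f # tl (signs A (Suc i) (Z f) js)" unfolding js' by (rule signs_Cons)
      finally show ?thesis by (simp add: le_diff_conv)
    qed
    show ?thesis
    proof
      assume l: ?l
      show ?r
      proof (intro allI impI)
        fix js assume js: "sorted_wrt (<) js" "length js = Suc (Suc l)" "hd js = i + e" "last js \<le> r + m"
        obtain j js' where jj: "js = (i + e) # js'" "j = hd js'" "length js' = Suc l"
          using js by (cases js) auto
        then have ne: "js' \<noteq> []" by auto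
        have sj: "sorted_wrt (<) js'" and "i + e < j" using js jj ne by auto
        moreover have "last js' \<le> r + m" using js jj ne by simp
        moreover have "j + Suc l \<le> Suc (last js')" using last_ge [OF sj ne] jj by simp
        ultimately have f: "j = Suc i + (j - Suc i)" "j - Suc i \<in> {e..<m}" using r by auto
        have "h - of_bool (Z (j - Suc i)) \<le> length (filter id (tl (signs A (Suc i) (Z (j - Suc i)) js')))"
          using l [rule_format, OF f(2) sj jj(3)] f(1) jj(2) \<open>last js' \<le> r + m\<close> by simp
        then show "h \<le> length (filter id (tl (signs A i Y js)))"
          using tl [of js' "j - Suc i"] f(1) jj by simp
      qed
    next
      assume rr: ?r
      show ?l
      proof (intro ballI allI impI)
        fix f js assume f: "f \<in> {e..<m}"
          and js: "sorted_wrt (<) js" "length js = Suc l" "hd js = Suc i + f" "last js \<le> r + m"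
        have ne: "js \<noteq> []" using js by auto
        have "\<forall>j\<in>set js. i + e < j"
        proof
          fix j assume "j \<in> set js"
          then have "hd js \<le> j" using js(1) ne by (cases js) auto
          then show "i + e < j" using f js(3) by simp
        qed
        then have "h \<le> length (filter id (tl (signs A i Y ((i + e) # js))))"
          using js ne by (intro rr [rule_format]) auto
        then show "h - of_bool (Z f) \<le> length (filter id (tl (signs A (Suc i) (Z f) js)))"
          using tl [OF js(2,3)] by simp
      qed
    qed
  qed
  finally show ?case .
qed

text \<open>A path whose first element is positive needs only \<open>k\<close> further positive elements, the
  other paths need \<open>k + 1\<close>.\<close>
lemma neighborly_iff_survives:
  assumes A: "sign_matrix r (r + m) A"
  shows "neighborly k (lawrence_om r (r + m) A) \<longleftrightarrow>
    survives (map (\<lambda>i. changes m (row A i)) [1..<Suc r]) (replicate m (Need (Suc k) k))"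
proof -
  have need: "need_of (replicate m (Need (Suc k) k)) e Y = Suc k - of_bool Y" if "e < m" for e Y
    using that by (simp add: need_of_def)
  have "survives (map (\<lambda>i. changes m (row A i)) [1..<Suc r]) (replicate m (Need (Suc k) k)) \<longleftrightarrow>
      (\<forall>e<m. \<forall>Y. yields m (map (row A) [1..<Suc r]) e Y (Suc k - of_bool Y))"
    using survives_iff_yields [of "replicate m (Need (Suc k) k)" m "map (row A) [1..<Suc r]"]
    by (simp add: need o_def del: upt_Suc)
  also have "\<dots> \<longleftrightarrow> (\<forall>e<m. \<forall>Y js. sorted_wrt (<) js \<longrightarrow> length js = Suc r \<longrightarrow> hd js = 1 + e \<longrightarrow>
      last js \<le> r + m \<longrightarrow> Suc k - of_bool Y \<le> length (filter id (tl (signs A 1 Y js))))"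
    using yields_rows_iff [OF A, of 1 r] by (simp del: upt_Suc)
  also have "\<dots> \<longleftrightarrow> (\<forall>js Y. supports r (r + m) js \<longrightarrow> k < length (filter id (signs A 1 Y js)))"
  proof -
    have sup: "supports r (r + m) js \<longleftrightarrow> sorted_wrt (<) js \<and> length js = Suc r \<and>
        (\<exists>e<m. hd js = 1 + e) \<and> last js \<le> r + m" for js
    proof (cases "sorted_wrt (<) js \<and> length js = Suc r")
      case True
      then have ne: "js \<noteq> []" by auto
      have "set js \<subseteq> {1..r + m} \<longleftrightarrow> 1 \<le> hd js \<and> last js \<le> r + m"
      proof
        show "1 \<le> hd js \<and> last js \<le> r + m" if "set js \<subseteq> {1..r + m}"
          using subsetD [OF that hd_in_set [OF ne]] subsetD [OF that last_in_set [OF ne]] by simp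
        have "hd js \<le> j \<and> j \<le> last js" if "j \<in> set js" for j
          using hd_le_last [OF _ that] True by blast
        then show "set js \<subseteq> {1..r + m}" if "1 \<le> hd js \<and> last js \<le> r + m" using that by fastforce
      qed
      moreover have "hd js + Suc r \<le> Suc (last js)" using last_ge [of js] True ne by simp
      ultimately show ?thesis using True
        by (auto simp: supports_def intro: exI [of _ "hd js - 1"])
    qed (auto simp: supports_def)
    have "Suc k - of_bool Y \<le> length (filter id (tl (signs A 1 Y js))) \<longleftrightarrow> k < length (filter id (signs A 1 Y js))"
      if len: "length js = Suc r" for js Y
    proof -
      obtain j js' where "js = j # js'" using len by (cases js) auto
      then have "signs A 1 Y js = Y # tl (signs A 1 Y js)" by (simp only: signs_Cons [symmetric])
      then have "filter id (signs A 1 Y js) = filter id (Y # tl (signs A 1 Y js))" by (rule arg_cong)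
      then have "length (filter id (signs A 1 Y js)) = of_bool Y + length (filter id (tl (signs A 1 Y js)))"
        by simp
      then show ?thesis by (cases Y) auto
    qed
    then show ?thesis unfolding sup by blast
  qed
  finally show ?thesis using neighborly_iff_signs [OF A] by blast
qed

section \<open>Neighborly reorientations and the chessboard\<close>

definition flip :: "nat set \<Rightarrow> (nat \<Rightarrow> nat \<Rightarrow> int) \<Rightarrow> nat \<Rightarrow> nat \<Rightarrow> int" where
  "flip R A i j = (if j \<in> R then - A i j else A i j)"

lemma sign_matrix_flip: "sign_matrix r n A \<Longrightarrow> sign_matrix r n (flip R A)"
  by (simp add: sign_matrix_def flip_def) fastforce

lemma reorient_vector_idem: "reorient_vector R (reorient_vector R X) = X"
  by (auto simp: reorient_vector_def)

lemma supp_reorient_vector: "supp (reorient_vector R X) = supp X"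
proof -
  have "- x = 1 \<longleftrightarrow> x = - 1" for x :: int by auto
  then show ?thesis by (auto simp: supp_def pos_def neg_def reorient_vector_def)
qed

lemma reorient_vector_circuit:
  assumes A: "sign_matrix r n A" and X: "X \<in> circuits (lawrence_om r n A)"
  shows "reorient_vector R X \<in> circuits (lawrence_om r n (flip R A))"
proof -
  have "reorient_vector R X \<in> sign_vectors {1..n}"
  proof -
    have "X \<in> sign_vectors {1..n}" using X unfolding circuits_lawrence_om [OF A] by simp
    moreover have "- x = 1 \<longleftrightarrow> x = - 1" for x :: int by auto
    ultimately show ?thesis by (auto simp: sign_vectors_def reorient_vector_def)
  qed
  moreover have "X' = - Y * a * b \<longleftrightarrow> (if s' then - X' else X') =
      - (if s then - Y else Y) * (if s then - a else a) * (if s' then - b else b)"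
    for X' Y a b :: int and s s' by auto
  moreover have "reorient_vector R X e = (if e \<in> R then - X e else X e)" for e
    by (simp add: reorient_vector_def)
  ultimately show ?thesis
    using X unfolding circuits_lawrence_om [OF A] circuits_lawrence_om [OF sign_matrix_flip [OF A]]
    by (simp add: supp_reorient_vector Let_def flip_def)
qed

lemma flip_flip: "flip R (flip R A) = A"
  by (auto simp: flip_def fun_eq_iff)

lemma ground_lawrence_om: "ground (lawrence_om r n A) = {1..n}"
  by (simp add: lawrence_om_def uniform_om_def)

lemma reorient_lawrence_om:
  assumes A: "sign_matrix r n A"
  shows "reorient R (lawrence_om r n A) = lawrence_om r n (flip R A)"
proof (rule prod_eqI)
  show "circuits (reorient R (lawrence_om r n A)) = circuits (lawrence_om r n (flip R A))"
  proof
    show "circuits (lawrence_om r n (flip R A)) \<subseteq> circuits (reorient R (lawrence_om r n A))"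
    proof
      fix X assume "X \<in> circuits (lawrence_om r n (flip R A))"
      then have "reorient_vector R X \<in> circuits (lawrence_om r n A)"
        using reorient_vector_circuit [OF sign_matrix_flip [OF A]] flip_flip by metis
      then show "X \<in> circuits (reorient R (lawrence_om r n A))"
        unfolding reorient_def snd_conv by (rule rev_image_eqI) (simp add: reorient_vector_idem)
    qed
  qed (auto simp: reorient_def reorient_vector_circuit [OF A])
qed (simp add: reorient_def ground_lawrence_om)

definition differs :: "(nat \<Rightarrow> nat \<Rightarrow> int) \<Rightarrow> nat \<Rightarrow> nat \<Rightarrow> bool" where
  "differs A i c \<longleftrightarrow> A i c \<noteq> A i (Suc c)"

definition cut :: "nat set \<Rightarrow> nat \<Rightarrow> bool" where
  "cut R c \<longleftrightarrow> (c \<in> R) \<noteq> (Suc c \<in> R)"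

lemma differs_flip:
  assumes "sign_matrix r n A" "1 \<le> i" "i \<le> r" "1 \<le> c" "c < n"
  shows "differs (flip R A) i c = (differs A i c \<noteq> cut R c)"
proof -
  have "A i c \<in> {-1, 1}" "A i (Suc c) \<in> {-1, 1}" using assms by (auto simp: sign_matrix_def)
  then show ?thesis by (auto simp: differs_def cut_def flip_def)
qed

text \<open>Row \<open>i\<close> of the chessboard lists the squares in rows \<open>i\<close>,
  \<open>i + 1\<close> and in columns \<open>c\<close>, \<open>c + 1\<close> for \<open>i < c \<le> i + l\<close>.
  These are the squares whose four entries all lie on paths.\<close>
definition chessboard :: "nat \<Rightarrow> nat \<Rightarrow> (nat \<Rightarrow> nat \<Rightarrow> int) \<Rightarrow> bool list list" where
  "chessboard r l A =
     map (\<lambda>i. map (\<lambda>j. differs A i (Suc i + j) \<noteq> differs A (Suc i) (Suc i + j)) [0..<l]) [1..<r]"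

lemma chessboard_in_words: "chessboard r l A \<in> words l (r - 1)"
  by (auto simp: chessboard_def words_def)

lemma chessboard_flip:
  assumes A: "sign_matrix r (r + Suc l) A"
  shows "chessboard r l (flip R A) = chessboard r l A"
proof -
  have "(differs (flip R A) i (Suc i + j) \<noteq> differs (flip R A) (Suc i) (Suc i + j)) =
      (differs A i (Suc i + j) \<noteq> differs A (Suc i) (Suc i + j))" if "1 \<le> i" "i < r" "j < l" for i j
    using that differs_flip [OF A, of i "Suc i + j"] differs_flip [OF A, of "Suc i" "Suc i + j"] by auto
  then show ?thesis by (auto simp: chessboard_def intro!: map_cong)
qed

text \<open>The first row in which the columns \<open>c\<close> and \<open>c + 1\<close> both lie on paths. In
  this row the bit of column \<open>c\<close> enters, as the free last bit or, if \<open>c \<le> l\<close>, among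
  the bits \<open>x\<close> of the first row.\<close>
definition first_row :: "nat \<Rightarrow> nat \<Rightarrow> nat" where
  "first_row l c = max 1 (c - l)"

lemma xor_map: "xor (map f xs) (map g xs) = map (\<lambda>x. f x \<noteq> g x) xs"
  by (induction xs) auto

lemma windows_rows:
  assumes "i + n = r"
  shows "1 \<le> i \<Longrightarrow> windows (map (\<lambda>j. differs A i (i + j) \<noteq> t (i + j)) [0..<l])
      (map (\<lambda>i. map (\<lambda>j. differs A i (Suc i + j) \<noteq> differs A (Suc i) (Suc i + j)) [0..<l]) [i..<r])
      (map (\<lambda>c. t c \<noteq> differs A (first_row l c) c) [i + l..<Suc (r + l)]) =
    map (\<lambda>i. map (\<lambda>j. differs A i (i + j) \<noteq> t (i + j)) [0..<Suc l]) [i..<Suc r]"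
  using assms
proof (induction n arbitrary: i)
  case 0
  then show ?case by (auto simp: first_row_def)
next
  case (Suc n)
  have i: "i < r" using Suc.prems by simp
  define b where "b = (t (i + l) \<noteq> differs A (first_row l (i + l)) (i + l))"
  define x where "x = map (\<lambda>j. differs A i (i + j) \<noteq> t (i + j)) [0..<l]"
  have x: "x @ [b] = map (\<lambda>j. differs A i (i + j) \<noteq> t (i + j)) [0..<Suc l]"
    using Suc.prems by (auto simp: x_def b_def first_row_def max_def)
  also have "[0..<Suc l] = 0 # map Suc [0..<l]" by (simp add: upt_conv_Cons map_Suc_upt del: upt_Suc)
  finally have "tl (x @ [b]) = map (\<lambda>j. differs A i (Suc i + j) \<noteq> t (Suc i + j)) [0..<l]"
    by simp
  then have next_x: "xor (tl (x @ [b])) (map (\<lambda>j. differs A i (Suc i + j) \<noteq> differs A (Suc i) (Suc i + j)) [0..<l]) =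
      map (\<lambda>j. differs A (Suc i) (Suc i + j) \<noteq> t (Suc i + j)) [0..<l]"
    by (auto simp: xor_map)
  have 1: "[i..<r] = i # [Suc i..<r]" "[i + l..<Suc (r + l)] = (i + l) # [Suc i + l..<Suc (r + l)]"
    "[i..<Suc r] = i # [Suc i..<Suc r]"
    using i by (simp_all add: upt_conv_Cons del: upt_Suc)
  show ?case
    unfolding 1 list.map x_def [symmetric] b_def [symmetric] windows.simps next_x
    using Suc.IH [of "Suc i"] Suc.prems by (simp add: x del: upt_Suc)
qed

definition codes :: "nat \<Rightarrow> (nat \<Rightarrow> bool) \<Rightarrow> nat set \<Rightarrow> bool list" where
  "codes n F R = map (\<lambda>c. cut R c \<noteq> F c) [1..<n]"

lemma card_bool_lists: "card {x::bool list. length x = n} = 2 ^ n"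
  using card_lists_length_eq [of "UNIV :: bool set" n] by simp

text \<open>A set of columns is determined by its boundary up to complement; fixing the membership of
  \<open>1\<close> makes the map bijective.\<close>
lemma card_codes:
  assumes "1 \<le> n"
  shows "card {R. R \<subseteq> {1..n} \<and> P (codes n F R)} = 2 * card {y. length y = n - 1 \<and> P y}"
proof -
  define \<Phi> where "\<Phi> R = (1 \<in> R, codes n F R)" for R
  have inj: "inj_on \<Phi> (Pow {1..n})"
  proof (rule inj_onI)
    fix R S assume RS: "R \<in> Pow {1..n}" "S \<in> Pow {1..n}" "\<Phi> R = \<Phi> S"
    then have cut: "cut R c = cut S c" if "1 \<le> c" "c < n" for c
      using that by (auto simp: \<Phi>_def codes_def)
    have "Suc j \<le> n \<Longrightarrow> Suc j \<in> R \<longleftrightarrow> Suc j \<in> S" for j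
    proof (induction j)
      case 0
      then show ?case using RS by (simp add: \<Phi>_def)
    next
      case (Suc j)
      then show ?case using cut [of "Suc j"] by (auto simp: cut_def)
    qed
    then show "R = S" using RS(1,2) by (metis PowD atLeastAtMost_iff not0_implies_Suc not_one_le_zero subset_antisym subsetI subset_iff)
  qed
  \<comment> \<open>An injection between finite sets of the same size, hence a bijection.\<close>
  have "\<Phi> ` Pow {1..n} \<subseteq> UNIV \<times> {y. length y = n - 1}" by (auto simp: \<Phi>_def codes_def)
  moreover have "finite (UNIV \<times> {y::bool list. length y = n - 1} :: (bool \<times> bool list) set)"
    using finite_bool_lists [of "n - 1" "\<lambda>_. True"] by simp
  moreover have "card (\<Phi> ` Pow {1..n}) = card (UNIV \<times> {y::bool list. length y = n - 1} :: (bool \<times> bool list) set)"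
    unfolding card_image [OF inj] using assms
    by (simp add: card_Pow card_cartesian_product card_bool_lists flip: power_Suc)
  ultimately have img: "\<Phi> ` Pow {1..n} = UNIV \<times> {y. length y = n - 1}" by (metis card_subset_eq)
  have 1: "\<Phi> ` {R. R \<subseteq> {1..n} \<and> P (codes n F R)} = UNIV \<times> {y. length y = n - 1 \<and> P y}"
  proof -
    have "\<Phi> ` {R. R \<subseteq> {1..n} \<and> P (codes n F R)} = {z \<in> \<Phi> ` Pow {1..n}. P (snd z)}"
      by (auto simp: \<Phi>_def)
    then show ?thesis unfolding img by auto
  qed
  have 2: "inj_on \<Phi> {R. R \<subseteq> {1..n} \<and> P (codes n F R)}"
    by (rule inj_on_subset [OF inj]) auto
  have "card {R. R \<subseteq> {1..n} \<and> P (codes n F R)} = card (UNIV \<times> {y. length y = n - 1 \<and> P y} :: (bool \<times> bool list) set)"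
    using card_image [OF 2] unfolding 1 by (rule sym)
  then show ?thesis by (simp add: card_cartesian_product)
qed

lemma card_split_lists:
  "card {y::bool list. length y = l + n \<and> P (take l y) (drop l y)} =
    (\<Sum>x | length x = l. card {bs. length bs = n \<and> P x bs})"
proof -
  let ?S = "SIGMA x:{x::bool list. length x = l}. {bs. length bs = n \<and> P x bs}"
  have "{y. length y = l + n \<and> P (take l y) (drop l y)} = (\<lambda>(x, bs). x @ bs) ` ?S"
  proof (intro set_eqI iffI)
    fix y assume "y \<in> {y. length y = l + n \<and> P (take l y) (drop l y)}"
    then have "(take l y, drop l y) \<in> ?S" "y = (\<lambda>(x, bs). x @ bs) (take l y, drop l y)" by auto
    then show "y \<in> (\<lambda>(x, bs). x @ bs) ` ?S" by blast
  qed auto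
  moreover have "inj_on (\<lambda>(x, bs). x @ bs) ?S" by (auto simp: inj_on_def)
  ultimately have "card {y. length y = l + n \<and> P (take l y) (drop l y)} = card ?S" by (simp add: card_image)
  also have "\<dots> = (\<Sum>x | length x = l. card {bs. length bs = n \<and> P x bs})"
    using finite_bool_lists [of l "\<lambda>_. True"] by (subst card_SigmaI) (auto simp: finite_bool_lists)
  finally show ?thesis .
qed

definition start :: "nat \<Rightarrow> nat \<Rightarrow> need list" where
  "start l k = replicate (Suc l) (Need (Suc k) k)"

text \<open>Adding the fixed bits of \<open>A\<close> to the boundary of the set of flipped columns turns the
  bits that enter row by row into free bits, while the dependence on \<open>A\<close> is confined to the
  chessboard.\<close>
lemma num_neighborly_eq:
  assumes A: "sign_matrix r (r + Suc l) A" and r: "1 \<le> r"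
  shows "num_neighborly (lawrence_om r (r + Suc l) A) k =
    2 * (\<Sum>x | length x = l. count (chessboard r l A) (start l k) x)"
proof -
  let ?n = "r + Suc l"
  define F where "F c = differs A (first_row l c) c" for c
  define P where "P x bs \<longleftrightarrow> survives (windows x (chessboard r l A) bs) (start l k)" for x bs
  have "neighborly k (reorient R (lawrence_om r ?n A)) \<longleftrightarrow> P (take l (codes ?n F R)) (drop l (codes ?n F R))" for R
  proof -
    have sf: "sign_matrix r (r + Suc l) (flip R A)" using A by (rule sign_matrix_flip)
    have ch: "changes (Suc l) (row (flip R A) i) = map (\<lambda>j. differs A i (i + j) \<noteq> cut R (i + j)) [0..<Suc l]"
      if "1 \<le> i" "i \<le> r" for i
    proof -
      have "(row (flip R A) i j \<noteq> row (flip R A) i (Suc j)) = (differs A i (i + j) \<noteq> cut R (i + j))"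
        if "j < Suc l" for j
      proof -
        have "flip R A i (i + j) \<in> {-1, 1}" "flip R A i (i + Suc j) \<in> {-1, 1}"
          using sf \<open>1 \<le> i\<close> \<open>i \<le> r\<close> that unfolding sign_matrix_def by auto
        then have "(row (flip R A) i j \<noteq> row (flip R A) i (Suc j)) = differs (flip R A) i (i + j)"
          by (auto simp: row_def differs_def)
        then show ?thesis using differs_flip [OF A, of i "i + j"] \<open>1 \<le> i\<close> \<open>i \<le> r\<close> that by simp
      qed
      then show ?thesis by (simp add: changes_def del: upt_Suc)
    qed
    have "take l (codes ?n F R) = map (\<lambda>j. differs A 1 (1 + j) \<noteq> cut R (1 + j)) [0..<l]"
      by (rule nth_equalityI) (auto simp: codes_def F_def first_row_def simp del: upt_Suc)
    moreover have "drop l (codes ?n F R) = map (\<lambda>c. cut R c \<noteq> differs A (first_row l c) c) [1 + l..<Suc (r + l)]"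
      by (simp add: codes_def F_def drop_map del: upt_Suc)
    ultimately have "windows (take l (codes ?n F R)) (chessboard r l A) (drop l (codes ?n F R)) =
        map (\<lambda>i. map (\<lambda>j. differs A i (i + j) \<noteq> cut R (i + j)) [0..<Suc l]) [1..<Suc r]"
      unfolding chessboard_def using windows_rows [of 1 "r - 1" r A "cut R" l] r by simp
    also have "\<dots> = map (\<lambda>i. changes (Suc l) (row (flip R A) i)) [1..<Suc r]"
      by (rule map_cong) (auto simp: ch)
    finally show ?thesis
      unfolding P_def reorient_lawrence_om [OF A] neighborly_iff_survives [OF sf] start_def by simp
  qed
  then have "num_neighborly (lawrence_om r ?n A) k =
      card {R. R \<subseteq> {1..?n} \<and> P (take l (codes ?n F R)) (drop l (codes ?n F R))}"
    by (simp add: num_neighborly_def ground_lawrence_om)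
  also have "\<dots> = 2 * card {y. length y = ?n - 1 \<and> P (take l y) (drop l y)}"
    by (rule card_codes [of ?n "\<lambda>y. P (take l y) (drop l y)" F]) simp
  also have "?n - 1 = l + r" by simp
  finally show ?thesis
    unfolding card_split_lists using r
    by (simp add: P_def count_eq_card chessboard_def)
qed

section \<open>Reorientation classes correspond to chessboards\<close>

lemma equal_entries_iff:
  assumes "\<And>c. j \<le> c \<Longrightarrow> c \<le> j' \<Longrightarrow> A i c \<in> {-1, 1} \<and> B i c \<in> {-1, 1}"
    and "\<And>c. j \<le> c \<Longrightarrow> c < j' \<Longrightarrow> differs A i c = differs B i c"
  shows "j \<le> j' \<Longrightarrow> (A i j = A i j') = (B i j = B i j')"
  using assms
proof (induction j')
  case (Suc j')
  show ?case
  proof (cases "j = Suc j'")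
    case False
    then have "j \<le> j'" using Suc.prems(1) by simp
    have "(A i j = A i j') = (B i j = B i j')"
      by (rule Suc.IH) (use Suc.prems \<open>j \<le> j'\<close> in simp_all)
    moreover have "differs A i j' = differs B i j'"
      using Suc.prems(3) [of j'] \<open>j \<le> j'\<close> by simp
    moreover have "(C j = C (Suc j')) = ((C j = C j') = (C j' = C (Suc j')))"
      if "C = A i \<or> C = B i" for C
    proof -
      have two: "x \<in> {-1, 1} \<Longrightarrow> y \<in> {-1, 1} \<Longrightarrow> z \<in> {-1, 1} \<Longrightarrow> (x = z) = ((x = y) = (y = z))"
        for x y z :: int by auto
      have "C j \<in> {-1, 1}" "C j' \<in> {-1, 1}" "C (Suc j') \<in> {-1, 1}"
        using that Suc.prems(2) \<open>j \<le> j'\<close> by (metis le_Suc_eq order_refl)+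
      then show ?thesis by (rule two)
    qed
    ultimately show ?thesis unfolding differs_def by blast
  qed simp
qed simp

text \<open>A path uses row \<open>i\<close> only between the columns \<open>i\<close> and
  \<open>i + l + 1\<close>, and only through the equality of two of its entries.\<close>
lemma lawrence_om_cong:
  assumes A: "sign_matrix r (r + Suc l) A" and B: "sign_matrix r (r + Suc l) B"
    and eq: "\<And>i c. 1 \<le> i \<Longrightarrow> i \<le> r \<Longrightarrow> i \<le> c \<Longrightarrow> c \<le> i + l \<Longrightarrow> differs A i c = differs B i c"
  shows "lawrence_om r (r + Suc l) A = lawrence_om r (r + Suc l) B"
proof -
  have signs: "signs A i Y js = signs B i Y js"
    if "sorted_wrt (<) js" "i + length js = Suc (Suc r)" "1 \<le> i" "js \<noteq> [] \<longrightarrow> i \<le> hd js \<and> last js \<le> r + Suc l" for i Y js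
    using that
  proof (induction js arbitrary: i Y)
    case (Cons j js)
    show ?case
    proof (cases js)
      case (Cons j' js')
      have "j < j'" "i \<le> j" using Cons.prems Cons by auto
      have "j' + length js \<le> Suc (last js)" using last_ge [of js] Cons.prems Cons by simp
      moreover have "last js \<le> r + Suc l" using Cons.prems Cons by simp
      ultimately have j': "j' \<le> Suc (i + l)" "i \<le> r" using Cons.prems Cons by auto
      have "(A i j = A i j') = (B i j = B i j')"
      proof (rule equal_entries_iff)
        show "A i c \<in> {-1, 1} \<and> B i c \<in> {-1, 1}" if "j \<le> c" "c \<le> j'" for c
          using A B that \<open>i \<le> j\<close> j' Cons.prems(3) by (auto simp: sign_matrix_def)
      qed (use eq \<open>i \<le> j\<close> \<open>j < j'\<close> j' Cons.prems in auto)
      moreover have "signs A (Suc i) Z js = signs B (Suc i) Z js" for Z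
        by (rule Cons.IH) (use Cons.prems Cons \<open>i \<le> j\<close> \<open>j < j'\<close> in auto)
      ultimately show ?thesis by (simp add: Cons)
    qed simp
  qed simp
  have "signs A 1 Y js = signs B 1 Y js" if js: "supports r (r + Suc l) js" for Y js
  proof (rule signs)
    have "js \<noteq> []" using js by (auto simp: supports_def)
    then have "hd js \<in> {1..r + Suc l}" "last js \<in> {1..r + Suc l}"
      using js hd_in_set last_in_set unfolding supports_def by blast+
    then show "js \<noteq> [] \<longrightarrow> 1 \<le> hd js \<and> last js \<le> r + Suc l" by simp
  qed (use js in \<open>auto simp: supports_def\<close>)
  then have "circuits (lawrence_om r (r + Suc l) A) = circuits (lawrence_om r (r + Suc l) B)"
    unfolding circuits_eq_signs [OF A] circuits_eq_signs [OF B] by auto metis+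
  then show ?thesis by (simp add: prod_eq_iff ground_lawrence_om)
qed

text \<open>Conversely, each of these bits is visible in a circuit, namely in one whose support has
  \<open>c\<close> and \<open>c + 1\<close> at consecutive positions and otherwise the first and last possible
  elements.\<close>
lemma differs_eq_if_lawrence_om_eq:
  assumes A: "sign_matrix r (r + Suc l) A" and B: "sign_matrix r (r + Suc l) B"
    and eq: "lawrence_om r (r + Suc l) A = lawrence_om r (r + Suc l) B"
    and i: "1 \<le> i" "i \<le> r" and c: "i \<le> c" "c \<le> i + l"
  shows "differs A i c = differs B i c"
proof -
  \<comment> \<open>The elements \<open>c\<close> and \<open>c + 1\<close> get the positions of row \<open>i\<close>; the others keep as far away as possible.\<close>
  define js where "js = [1..<i] @ [c, Suc c] @ [i + l + 2..<Suc (r + Suc l)]"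
  have js: "supports r (r + Suc l) js"
    using i c by (auto simp: supports_def js_def sorted_wrt_append simp del: upt_Suc)
  have nth: "js ! (i - 1) = c" "js ! i = Suc c" using i by (auto simp: js_def nth_append)
  have len: "length js = Suc r" using js by (simp add: supports_def)
  define ys where "ys = signs A 1 True js"
  define X where "X = vector_of js ys"
  have ys0: "ys ! 0 = True" unfolding ys_def by (rule signs_nth_0) (use len in auto)
  have "X \<in> circuits (lawrence_om r (r + Suc l) A)"
    unfolding circuits_eq_signs [OF A] X_def ys_def using js by blast
  then have "X \<in> circuits (lawrence_om r (r + Suc l) B)" using eq by simp
  then have ysB: "ys = signs B 1 True js"
    using circuit_nth [OF B js, of X ys] len ys0 by (simp add: X_def ys_def)
  obtain p where p: "i = Suc p" using i(1) by (cases i) auto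
  have "Suc p < length js" using i len p by simp
  then have "ys ! Suc p = (ys ! p \<noteq> (C (1 + p) (js ! p) = C (1 + p) (js ! Suc p)))"
    if "ys = signs C 1 True js" for C using signs_nth_Suc that by metis
  from this [OF ys_def] this [OF ysB] show ?thesis
    using nth by (auto simp: p differs_def)
qed

lemma chessboard_nth:
  "1 \<le> i \<Longrightarrow> i < r \<Longrightarrow> j < l \<Longrightarrow>
    chessboard r l A ! (i - 1) ! j = (differs A i (Suc i + j) \<noteq> differs A (Suc i) (Suc i + j))"
  by (simp add: chessboard_def)

lemma chessboard_eqI:
  assumes "\<And>i c. 1 \<le> i \<Longrightarrow> i \<le> r \<Longrightarrow> i \<le> c \<Longrightarrow> c \<le> i + l \<Longrightarrow> differs A i c = differs B i c"
  shows "chessboard r l A = chessboard r l B"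
  using assms by (auto simp: chessboard_def intro!: map_cong)

lemma ex_cut: "\<exists>R\<subseteq>{1..n}. \<forall>c. 1 \<le> c \<longrightarrow> c < n \<longrightarrow> cut R c = t c"
proof (induction n)
  case (Suc n)
  then obtain R where R: "R \<subseteq> {1..n}" "\<And>c. 1 \<le> c \<Longrightarrow> c < n \<Longrightarrow> cut R c = t c" by blast
  \<comment> \<open>The element \<open>n + 1\<close> is put in or left out so that the boundary at \<open>n\<close> is as prescribed.\<close>
  define S where "S = (if (n \<in> R) \<noteq> t n then insert (Suc n) R else R)"
  have "Suc n \<notin> R" using R by auto
  then have "cut S c = t c" if "1 \<le> c" "c < Suc n" for c
    using R(2) [of c] that by (cases "c = n") (auto simp: S_def cut_def)
  moreover have "S \<subseteq> {1..Suc n}" using R(1) by (auto simp: S_def)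
  ultimately show ?case by blast
qed simp

text \<open>If the chessboards agree, then the rows of the two matrices differ in column \<open>c\<close> in the
  same way for all rows that matter, and flipping columns removes this difference.\<close>
lemma lawrence_om_flip_if_chessboard_eq:
  assumes A: "sign_matrix r (r + Suc l) A" and B: "sign_matrix r (r + Suc l) B"
    and eq: "chessboard r l A = chessboard r l B"
  obtains R where "R \<subseteq> {1..r + Suc l}" "lawrence_om r (r + Suc l) B = lawrence_om r (r + Suc l) (flip R A)"
proof -
  \<comment> \<open>The rows in which column \<open>c\<close> matters all agree on \<open>t c\<close>; the first of them serves as the definition.\<close>
  define t where "t c = (differs A (first_row l c) c \<noteq> differs B (first_row l c) c)" for c
  have t: "(differs A i c \<noteq> differs B i c) = t c" if "1 \<le> i" "i \<le> r" "i \<le> c" "c \<le> i + l" for i c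
    using that
  proof (induction i)
    case (Suc i)
    show ?case
    proof (cases "first_row l c = Suc i")
      case False
      then have i: "1 \<le> i" "i < r" "i \<le> c" "c \<le> i + l" and j: "c - Suc i < l" "Suc i + (c - Suc i) = c"
        using Suc.prems by (auto simp: first_row_def max_def split: if_splits)
      have "(differs A i c \<noteq> differs A (Suc i) c) = (differs B i c \<noteq> differs B (Suc i) c)"
        using chessboard_nth [OF i(1,2) j(1), of A] chessboard_nth [OF i(1,2) j(1), of B] j(2) eq by simp
      then show ?thesis using Suc.IH i by auto
    qed (simp add: t_def)
  qed simp
  obtain R where R: "R \<subseteq> {1..r + Suc l}" "\<And>c. 1 \<le> c \<Longrightarrow> c < r + Suc l \<Longrightarrow> cut R c = t c"
    using ex_cut [of "r + Suc l" t] by blast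
  have "lawrence_om r (r + Suc l) B = lawrence_om r (r + Suc l) (flip R A)"
  proof (rule lawrence_om_cong [OF B sign_matrix_flip [OF A]])
    fix i c assume i: "1 \<le> i" "i \<le> r" "i \<le> c" "c \<le> i + l"
    then show "differs B i c = differs (flip R A) i c"
      using differs_flip [OF A, of i c R] R(2) [of c] t [OF i] by auto
  qed
  then show ?thesis using R(1) that by blast
qed

lemma reorient_reorient: "reorient R (reorient S M) = reorient ((R - S) \<union> (S - R)) M"
proof -
  have "reorient_vector R (reorient_vector S X) = reorient_vector ((R - S) \<union> (S - R)) X" for X
    by (auto simp: reorient_vector_def)
  then show ?thesis by (simp add: reorient_def image_image)
qed

lemma reorient_empty: "reorient {} M = M"
  by (simp add: reorient_def reorient_vector_def)

lemma self_in_reorientation_class: "M \<in> reorientation_class M"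
  unfolding reorientation_class_def by (rule CollectI, rule exI [of _ "{}"]) (simp add: reorient_empty)

lemma reorientation_class_reorient:
  assumes "R \<subseteq> ground M"
  shows "reorientation_class (reorient R M) = reorientation_class M"
proof -
  have sub: "reorientation_class (reorient R M) \<subseteq> reorientation_class M" if "R \<subseteq> ground M" for R and M :: "'a oriented_matroid"
  proof
    fix N assume "N \<in> reorientation_class (reorient R M)"
    then obtain S where "S \<subseteq> ground M" "N = reorient S (reorient R M)"
      by (auto simp: reorientation_class_def reorient_def)
    then show "N \<in> reorientation_class M"
      using that unfolding reorientation_class_def reorient_reorient by blast
  qed
  have "reorient R (reorient R M) = M" by (simp add: reorient_reorient reorient_empty)
  then show ?thesis
    using sub [OF assms] sub [of R "reorient R M"] assms by (simp add: reorient_def)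
qed

lemma reorientation_class_eq_iff:
  assumes A: "sign_matrix r (r + Suc l) A" and B: "sign_matrix r (r + Suc l) B"
  shows "reorientation_class (lawrence_om r (r + Suc l) A) = reorientation_class (lawrence_om r (r + Suc l) B)
    \<longleftrightarrow> chessboard r l A = chessboard r l B"
proof
  assume "reorientation_class (lawrence_om r (r + Suc l) A) = reorientation_class (lawrence_om r (r + Suc l) B)"
  then have "lawrence_om r (r + Suc l) B \<in> reorientation_class (lawrence_om r (r + Suc l) A)"
    using self_in_reorientation_class by metis
  then obtain R where "lawrence_om r (r + Suc l) B = reorient R (lawrence_om r (r + Suc l) A)"
    unfolding reorientation_class_def by blast
  then have "lawrence_om r (r + Suc l) B = lawrence_om r (r + Suc l) (flip R A)"
    by (simp only: reorient_lawrence_om [OF A])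
  then have "chessboard r l B = chessboard r l (flip R A)"
    by (intro chessboard_eqI differs_eq_if_lawrence_om_eq [OF B sign_matrix_flip [OF A]])
  then show "chessboard r l A = chessboard r l B" by (simp add: chessboard_flip [OF A])
next
  assume "chessboard r l A = chessboard r l B"
  then obtain R where "R \<subseteq> {1..r + Suc l}" "lawrence_om r (r + Suc l) B = reorient R (lawrence_om r (r + Suc l) A)"
    using lawrence_om_flip_if_chessboard_eq [OF A B] reorient_lawrence_om [OF A] by metis
  then show "reorientation_class (lawrence_om r (r + Suc l) A) = reorientation_class (lawrence_om r (r + Suc l) B)"
    by (simp add: reorientation_class_reorient ground_lawrence_om)
qed

section \<open>Chessboards with constant columns\<close>

text
  \<open>A matrix with a given chessboard: integrating the word down the columns gives the positions at which the entries change, and integrating these along the rows gives the entries.\<close>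
primrec word_differs :: "bool list list \<Rightarrow> nat \<Rightarrow> nat \<Rightarrow> nat \<Rightarrow> bool" where
  "word_differs w l 0 c \<longleftrightarrow> False"
| "word_differs w l (Suc i) c \<longleftrightarrow> word_differs w l i c \<noteq>
     (1 \<le> i \<and> i \<le> length w \<and> Suc i \<le> c \<and> c < Suc i + l \<and> w ! (i - 1) ! (c - Suc i))"

primrec word_matrix :: "bool list list \<Rightarrow> nat \<Rightarrow> nat \<Rightarrow> nat \<Rightarrow> int" where
  "word_matrix w l i 0 = 1"
| "word_matrix w l i (Suc j) = (if word_differs w l i j then - word_matrix w l i j else word_matrix w l i j)"

lemma word_matrix_sign: "word_matrix w l i j \<in> {-1, 1}"
  by (induction j) auto

lemma sign_matrix_word_matrix: "sign_matrix r n (word_matrix w l)"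
  unfolding sign_matrix_def using word_matrix_sign by blast

lemma chessboard_word_matrix:
  assumes "w \<in> words l (r - 1)"
  shows "chessboard r l (word_matrix w l) = w"
proof -
  have len: "length w = r - 1" "\<And>i. i < r - 1 \<Longrightarrow> length (w ! i) = l" using assms by (auto simp: words_def)
  have d: "differs (word_matrix w l) i c = word_differs w l i c" for i c
    using word_matrix_sign [of w l i c] by (auto simp: differs_def)
  show ?thesis
  proof (rule nth_equalityI)
    fix i assume "i < length (chessboard r l (word_matrix w l))"
    then have i: "i < r - 1" by (simp add: chessboard_def)
    show "chessboard r l (word_matrix w l) ! i = w ! i"
    proof (rule nth_equalityI)
      show "length (chessboard r l (word_matrix w l) ! i) = length (w ! i)" using i len by (simp add: chessboard_def)
      fix j assume "j < length (chessboard r l (word_matrix w l) ! i)"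
      then have "j < l" using i by (simp add: chessboard_def)
      then show "chessboard r l (word_matrix w l) ! i ! j = w ! i ! j"
        using chessboard_nth [of "Suc i" r j l "word_matrix w l"] i len by (auto simp: d)
    qed
  qed (simp add: chessboard_def len)
qed

lemma loms_eq: "loms r (r + Suc l) = {lawrence_om r (r + Suc l) A | A. sign_matrix r (r + Suc l) A}"
  by (simp add: loms_def)

text
  \<open>A regular word is extended to the left by a letter in which only the first square can be chosen.\<close>
lemma card_regular_words: "1 \<le> l \<Longrightarrow> card {w \<in> words l (Suc n). regular w} = 2 ^ (l + n)"
proof (induction n)
  case 0
  have "{w \<in> words l (Suc 0). regular w} = (\<lambda>L. [L]) ` {L. length L = l}"
    by (auto simp: words_def length_Suc_conv)
  then show ?case by (simp add: card_image inj_on_def card_bool_lists)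
next
  case (Suc n)
  let ?W = "\<lambda>n. {w \<in> words l (Suc n). regular w}"
  have "?W (Suc n) = (\<lambda>(b, w). (b # butlast (hd w)) # w) ` (UNIV \<times> ?W n)"
  proof (intro set_eqI iffI)
    fix v assume v: "v \<in> ?W (Suc n)"
    then obtain L w where w: "v = L # w" "length L = l" "w \<in> words l (Suc n)" by (auto simp: words_Suc)
    then obtain K w' where K: "w = K # w'" by (auto simp: words_Suc)
    obtain b L' where "L = b # L'" using w(2) Suc.prems by (cases L) auto
    then show "v \<in> (\<lambda>(b, w). (b # butlast (hd w)) # w) ` (UNIV \<times> ?W n)"
      using v w K by (auto intro!: image_eqI [of _ _ "(b, w)"])
  next
    fix v assume "v \<in> (\<lambda>(b, w). (b # butlast (hd w)) # w) ` (UNIV \<times> ?W n)"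
    then obtain b w where w: "v = (b # butlast (hd w)) # w" "w \<in> ?W n" by auto
    then obtain K w' where "w = K # w'" "length K = l" by (auto simp: words_Suc)
    then show "v \<in> ?W (Suc n)" using w Suc.prems by (auto simp: words_def)
  qed
  moreover have "inj_on (\<lambda>(b, w). (b # butlast (hd w)) # w) (UNIV \<times> ?W n)" by (auto simp: inj_on_def)
  ultimately show ?case
    using Suc by (simp add: card_image card_cartesian_product)
qed

lemma regular_white: "regular (replicate n (replicate l False))"
proof (induction n)
  case (Suc n)
  have "tl (replicate l False) = butlast (replicate l False)" by (simp add: butlast_conv_take min_def)
  then show ?case using Suc by (cases n) auto
qed simp

lemma chessboard_alternating: "chessboard r l (\<lambda>i j. 1) = replicate (r - 1) (replicate l False)"
  by (auto simp: chessboard_def differs_def map_replicate_const)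

text \<open>The computation turns into the statement on oriented matroids: the classes correspond to the words,
  the value \<open>c\<close> is attained exactly at the regular ones, and the class of the alternating oriented
  matroid, one of them, is left out.\<close>
lemma lom_extremality:
  assumes ver: "verified (num_of_nat c) l r (Single (start l k)) hs" and c: "0 < c" and r: "2 \<le> r" and l: "1 \<le> l"
    and n: "n = r + Suc l"
  shows "(\<forall>M\<in>loms r n. M \<notin> reorientation_class (alternating_om r n) \<longrightarrow> num_neighborly M k \<le> alternating_num r n k) \<and>
    card (extremal_lom_classes r n k) = 2 ^ (n - 3) - 1"
proof -
  define N where "N w = (\<Sum>x | length x = l. count w (start l k) x)" for w
  define white where "white = replicate (r - 1) (replicate l False)"
  define M where "M A = lawrence_om r n A" for A
  define W where "W = words l (r - 1)"
  obtain r' where r': "r = Suc (Suc r')" using r by (metis Suc_le_D numeral_2_eq_2 Suc_le_mono)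
  have val: "if regular w then N w = c else N w < c" if "w \<in> W" for w
  proof -
    have c': "numeral (num_of_nat c) = c" using c by (rule numeral_num_of_nat)
    have "verified (num_of_nat c) l (Suc (Suc r')) (Single (start l k)) hs" using ver by (simp only: r')
    moreover have "length (start l k) = Suc l" by (simp add: start_def)
    moreover have "w \<in> words l (Suc r')" using that by (simp add: W_def r')
    ultimately show ?thesis unfolding N_def by (rule verified_count [of "num_of_nat c", unfolded c'])
  qed
  have sign1: "sign_matrix r n (\<lambda>i j. 1)" by (simp add: sign_matrix_def)
  have alt: "alternating_om r n = M (\<lambda>i j. 1)" by (simp add: M_def lawrence_om_const_1)
  have num: "num_neighborly (M A) k = 2 * N (chessboard r l A)" if "sign_matrix r n A" for A
    using num_neighborly_eq [of r l A k] that r by (simp add: M_def N_def n)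
  have cls: "reorientation_class (M A) = reorientation_class (M B) \<longleftrightarrow> chessboard r l A = chessboard r l B"
    if "sign_matrix r n A" "sign_matrix r n B" for A B
    using reorientation_class_eq_iff that by (simp add: M_def n)
  have white: "chessboard r l (\<lambda>i j. 1) = white" by (simp add: white_def chessboard_alternating)
  have inW: "chessboard r l A \<in> W" for A unfolding W_def by (rule chessboard_in_words)
  have reg_white: "regular white" by (simp add: white_def regular_white)
  have alt_num: "alternating_num r n k = 2 * c"
    using num [OF sign1] val [OF inW, of "\<lambda>i j. 1"] reg_white by (simp add: alternating_num_def alt white)
  have in_alt: "M A \<in> reorientation_class (alternating_om r n) \<longleftrightarrow> chessboard r l A = white"
    if A: "sign_matrix r n A" for A
  proof
    assume "M A \<in> reorientation_class (alternating_om r n)"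
    then obtain R where R: "R \<subseteq> ground (alternating_om r n)" "M A = reorient R (alternating_om r n)"
      by (auto simp: reorientation_class_def)
    then have "reorientation_class (M A) = reorientation_class (M (\<lambda>i j. 1))"
      by (simp add: reorientation_class_reorient alt)
    then show "chessboard r l A = white" using cls [OF A sign1] white by simp
  next
    assume "chessboard r l A = white"
    then have "reorientation_class (M A) = reorientation_class (alternating_om r n)"
      using cls [OF A sign1] white alt by simp
    then show "M A \<in> reorientation_class (alternating_om r n)" using self_in_reorientation_class by blast
  qed
  have loms: "loms r n = {M A | A. sign_matrix r n A}" unfolding n M_def by (rule loms_eq)
  have le: "N w \<le> c" if "w \<in> W" for w using val [OF that] by (simp split: if_splits)
  have "num_neighborly X k \<le> alternating_num r n k" if "X \<in> loms r n" for X
    using that le [OF inW] by (auto simp: loms num alt_num)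
  moreover have "extremal_lom_classes r n k =
      (\<lambda>w. reorientation_class (M (word_matrix w l))) ` ({w \<in> W. regular w} - {white})"
  proof -
    have real: "chessboard r l (word_matrix w l) = w" if "w \<in> W" for w
      using that chessboard_word_matrix by (simp add: W_def)
    have N_iff: "N w = c \<longleftrightarrow> regular w" if "w \<in> W" for w using val [OF that] by (auto split: if_splits)
    have "M A \<notin> reorientation_class (alternating_om r n) \<and> num_neighborly (M A) k = alternating_num r n k \<longleftrightarrow>
        chessboard r l A \<noteq> white \<and> regular (chessboard r l A)" if "sign_matrix r n A" for A
      using N_iff [OF inW] that by (simp add: in_alt num alt_num)
    then have "extremal_lom_classes r n k = {reorientation_class (M A) | A. sign_matrix r n A \<and>
        chessboard r l A \<noteq> white \<and> regular (chessboard r l A)}"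
      unfolding extremal_lom_classes_def loms by blast
    also have "\<dots> = (\<lambda>w. reorientation_class (M (word_matrix w l))) ` ({w \<in> W. regular w} - {white})"
    proof (intro set_eqI iffI)
      fix K assume "K \<in> {reorientation_class (M A) | A. sign_matrix r n A \<and>
        chessboard r l A \<noteq> white \<and> regular (chessboard r l A)}"
      then obtain A where A: "sign_matrix r n A" "K = reorientation_class (M A)"
        "chessboard r l A \<in> {w \<in> W. regular w} - {white}" using inW by auto
      moreover have "K = reorientation_class (M (word_matrix (chessboard r l A) l))"
        unfolding A(2) cls [OF A(1) sign_matrix_word_matrix] by (simp add: real inW)
      ultimately show "K \<in> (\<lambda>w. reorientation_class (M (word_matrix w l))) ` ({w \<in> W. regular w} - {white})"
        by blast
    next
      fix K assume "K \<in> (\<lambda>w. reorientation_class (M (word_matrix w l))) ` ({w \<in> W. regular w} - {white})"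
      then obtain w where "K = reorientation_class (M (word_matrix w l))" "w \<in> W" "regular w" "w \<noteq> white" by auto
      then show "K \<in> {reorientation_class (M A) | A. sign_matrix r n A \<and>
        chessboard r l A \<noteq> white \<and> regular (chessboard r l A)}"
        using sign_matrix_word_matrix real by (intro CollectI exI [of _ "word_matrix w l"]) simp
    qed
    finally show ?thesis .
  qed
  moreover have "inj_on (\<lambda>w. reorientation_class (M (word_matrix w l))) ({w \<in> W. regular w} - {white})"
    using chessboard_word_matrix by (auto simp: inj_on_def cls sign_matrix_word_matrix W_def)
  moreover have "card ({w \<in> W. regular w} - {white}) = 2 ^ (n - 3) - 1"
  proof -
    have "white \<in> {w \<in> W. regular w}" using reg_white inW [of "\<lambda>i j. 1"] white by simp
    then have "card ({w \<in> W. regular w} - {white}) = card {w \<in> W. regular w} - 1" by simp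
    also have "card {w \<in> W. regular w} = 2 ^ (l + r')"
      using card_regular_words [OF l, of r'] by (simp add: W_def r')
    finally show ?thesis by (simp add: n r' add.commute)
  qed
  ultimately show ?thesis by (simp add: card_image)
qed

section \<open>The computations for rank nine\<close>

text \<open>
  The cluster numbers, for the rows \<open>2\<close> to \<open>8\<close>, for each function recorded behind the row and for each
  letter, with \<open>0\<close> in the place of regular extensions. They come from a greedy search that merges as
  much as possible while the bounds stay below the target. The targets \<open>747\<close>, \<open>99\<close> and \<open>79\<close> are half
  the numbers of neighborly reorientations of the alternating oriented matroids.\<close>

definition hints_12_2 :: "nat list list list" where
  "hints_12_2 =
    [[[0,0,0,1], [0,0,1,0], [0,0,0,1], [0,0,1,0], [0,0,1,1], [0,0,1,1], [2,2,3,3], [2,2,3,3], [4,4,5,5],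
    [4,4,5,5]], [[0,0,0,1], [0,0,1,0], [0,0,0,1], [0,0,1,0], [2,0,3,1], [0,4,1,5]], [[0,0,0,1],
    [0,0,1,0], [0,0,0,1], [0,0,1,0], [0,0,1,1], [0,0,1,1]], [[0,0,0,1], [0,0,1,0], [0,0,0,1], [0,0,1,0],
    [0,0,1,1], [0,0,1,1]], [[0,0,0,1], [0,0,1,0], [0,0,0,1], [0,0,1,0], [0,0,1,1], [0,0,1,1]],
    [[0,0,0,1], [0,0,0,1], [0,0,1,0], [0,0,1,0]], [[0,0,0,0]]]"

definition hints_12_3 :: "nat list list list" where
  "hints_12_3 =
    [[[0,0,0,1], [0,0,1,0], [0,0,0,1], [0,0,1,0], [2,2,3,3], [2,2,3,3]], [[0,0,0,1], [0,0,1,0],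
    [0,0,0,1], [0,0,1,0], [0,0,1,1], [0,0,1,1], [0,0,1,1], [0,0,1,1]], [[0,0,0,1], [0,0,1,0], [0,0,0,1],
    [0,0,1,0], [2,2,3,3], [2,2,3,3]], [[0,0,0,1], [0,0,1,0], [0,0,0,1], [0,0,1,0], [0,0,1,1],
    [0,0,1,1]], [[0,0,0,1], [0,0,1,0], [0,0,0,1], [0,0,1,0], [0,0,1,1], [0,0,1,1]], [[0,0,0,1],
    [0,0,0,1], [0,0,1,0], [0,0,1,0]], [[0,0,0,0]]]"

definition hints_13_3 :: "nat list list list" where
  "hints_13_3 =
    [[[0,0,1,1,0,2,3,4], [0,0,0,1,5,2,0,4], [0,0,1,1,2,0,4,3], [0,0,1,0,2,5,4,0], [0,0,1,1,0,2,3,4],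
    [0,0,0,1,5,2,0,4], [0,0,1,1,2,0,4,3], [0,0,1,0,2,5,4,0], [6,0,7,1,8,9,10,4],
    [11,11,12,12,13,13,14,14], [15,15,16,1,17,2,18,18], [11,11,12,12,13,13,14,14], [0,6,1,7,8,8,10,10],
    [0,0,1,1,5,5,3,3], [0,19,1,20,2,2,4,4], [21,21,22,22,9,9,23,23], [24,24,25,25,26,26,27,27],
    [28,28,29,29,9,30,31,31], [32,32,33,33,34,34,35,35], [15,15,1,1,17,17,3,4], [0,0,7,1,5,9,10,10],
    [15,15,1,16,17,17,18,18], [32,32,33,33,34,34,35,35], [28,28,29,29,30,9,31,31],
    [36,36,37,37,38,38,39,39], [24,24,22,22,26,26,23,23]], [[0,0,1,1,0,2,1,1], [3,3,0,4,3,3,0,4],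
    [0,0,1,1,2,0,1,1], [3,3,4,0,3,3,4,0], [0,0,1,1,0,2,1,1], [3,3,0,4,3,3,0,4], [0,0,1,1,2,0,1,1],
    [3,3,4,0,3,3,4,0], [5,5,1,1,5,5,1,1], [5,5,1,1,5,5,1,1], [3,3,6,6,3,3,6,6], [3,3,6,6,3,3,6,6],
    [7,7,1,1,8,8,1,1], [7,7,1,1,8,8,1,1], [3,3,9,9,3,3,10,10], [3,3,9,9,3,3,10,10], [11,7,1,1,12,8,1,1],
    [7,11,1,1,8,12,1,1], [3,3,10,10,3,3,9,9], [3,3,10,10,3,3,9,9], [0,0,1,1,2,2,1,1],
    [3,3,4,4,3,3,13,13], [0,0,1,1,2,2,1,1], [3,3,4,4,3,3,13,13], [0,14,1,1,2,15,1,1],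
    [3,3,13,13,3,3,4,4], [16,16,1,1,16,16,1,1], [3,3,17,17,3,3,17,17], [14,0,1,1,15,2,1,1],
    [3,3,13,13,3,3,4,4]], [[0,0,1,1,0,2,3,3], [0,0,0,1,2,2,0,3], [0,0,1,1,2,0,3,3], [0,0,1,0,2,2,3,0],
    [0,0,1,1,0,2,3,3], [0,0,0,1,2,2,0,3], [0,0,1,1,2,0,3,3], [0,0,1,0,2,2,3,0], [4,0,5,5,6,2,7,7],
    [4,4,5,5,6,6,7,7], [8,8,9,1,10,10,11,3], [8,8,9,9,10,10,11,11], [12,4,5,5,13,6,7,7],
    [0,12,5,14,2,13,7,15], [8,8,16,9,10,10,17,11], [0,0,1,1,2,2,3,3], [0,0,1,1,2,2,3,3],
    [0,18,1,18,2,19,3,19], [8,8,9,1,10,2,11,3], [4,0,5,5,6,2,7,7], [8,20,1,16,10,21,3,17],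
    [8,20,1,16,10,21,3,17], [0,12,5,14,2,13,7,15], [20,8,16,1,21,10,17,3], [12,0,14,5,13,2,15,7]],
    [[0,0,1,1,0,2,3,3], [4,4,0,5,6,6,0,5], [0,0,1,1,2,0,3,3], [4,4,5,0,6,6,5,0], [0,0,1,1,0,2,3,3],
    [4,4,0,5,6,6,0,5], [0,0,1,1,2,0,3,3], [4,4,5,0,6,6,5,0], [7,7,8,8,7,7,8,8], [4,4,9,9,6,6,9,9],
    [0,2,1,1,2,2,3,3], [10,11,1,1,11,10,3,3], [4,4,5,5,6,6,12,5], [4,4,13,14,6,6,14,13],
    [0,15,1,1,2,16,3,3], [4,4,5,12,6,6,5,5]], [[0,0,0,0,0,0,1,0], [0,0,0,0,1,0,0,0], [0,0,0,0,0,0,1,0],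
    [0,0,0,0,1,0,0,0], [0,0,0,0,0,0,0,1], [0,0,0,0,0,1,0,0], [0,0,0,0,0,0,0,1], [0,0,0,0,0,1,0,0],
    [2,2,3,3,4,4,5,5], [3,3,6,6,5,5,7,7]], [[0,0,0,0,0,1,1,0], [0,0,0,0,0,1,1,0], [0,0,0,0,1,0,0,1],
    [0,0,0,0,1,0,0,1], [0,0,0,0,1,1,0,0], [0,0,0,0,1,1,0,0], [0,0,0,0,1,1,0,0], [0,0,0,0,1,1,0,0]],
    [[0,0,0,0,0,0,0,0]]]"

lemma verified_12_2: "verified (num_of_nat 747) 2 9 (Single (start 2 2)) hints_12_2"
  by code_simp

lemma verified_12_3: "verified (num_of_nat 99) 2 9 (Single (start 2 3)) hints_12_3"
  by code_simp

lemma verified_13_3: "verified (num_of_nat 79) 3 9 (Single (start 3 3)) hints_13_3"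
  by code_simp

theorem theorem2p28:
  "((\<forall>M \<in> loms 9 12. M \<notin> reorientation_class (alternating_om 9 12) \<longrightarrow>
        num_neighborly M 2 \<le> alternating_num 9 12 2) \<and>
      card (extremal_lom_classes 9 12 2) = 511) \<and>
   ((\<forall>M \<in> loms 9 12. M \<notin> reorientation_class (alternating_om 9 12) \<longrightarrow>
        num_neighborly M 3 \<le> alternating_num 9 12 3) \<and>
      card (extremal_lom_classes 9 12 3) = 511) \<and>
   ((\<forall>M \<in> loms 9 13. M \<notin> reorientation_class (alternating_om 9 13) \<longrightarrow>
        num_neighborly M 3 \<le> alternating_num 9 13 3) \<and>
      card (extremal_lom_classes 9 13 3) = 1023)"
  using lom_extremality [OF verified_12_2, of 12] lom_extremality [OF verified_12_3, of 12]
    lom_extremality [OF verified_13_3, of 13]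
  by simp

end
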